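(* Let $1\le k\le n-1$, let $K$ be an origin-symmetric star body in $\mathbb{R}^n$, and let $f$ be a non-negative even continuous function on $\mathbb{R}^n$. Then $$\int_{S^{n-1}} \rho_K^{n-1}(\theta)\, f(\rho_K(\theta)\theta)\, d\theta \le c_{n,k}^k\; d_{\rm ovr}^k(K,\mathcal{BP}_k^n)\; |K|^{\frac{k}{n}} \max_{E\in \mathrm{Gr}_{n-k}} \int_{S^{n-1}\cap E} \rho_K^{n-k-1}(\theta)\, f(\rho_K(\theta)\theta)\, d\theta ,$$ where $$c_{n,k}^k=\frac{n\,\omega_n^{\frac{n-k}{n}}}{(n-k)\,\omega_{n-k}} .$$
   Context: $|\cdot|$ denotes volume in the appropriate dimension, $\omega_m$ is the volume of the Euclidean unit ball in $\mathbb{R}^m$, and $\mathrm{Gr}_{m}$ is the Grassmannian of $m$-dimensional linear subspaces of $\mathbb{R}^n$. The symbol $d\theta$ denotes the non-normalized surface measure (density 1) on the sphere $S^{n-1}$, or on the sphere $S^{n-1}\cap E$ of a subspace $E$ (counting measure on the two points if $\dim E=1$). A compact set $K\subset\mathbb{R}^n$ is star-shaped at $0$ if it contains the origin in its interior and every line through $0$ meets $K$ in a line segment; its radial function is $\rho_K(\theta)=\max\{\lambda>0:\lambda\theta\in K\}$, $\theta\in S^{n-1}$. If $\rho_K$ is continuous, $K$ is called a star body. Origin-symmetric means $K=-K$. For $1\le k\le n-1$, the $(n-k)$-dimensional spherical Radon transform $R_{n-k}:C(S^{n-1})\to C(\mathrm{Gr}_{n-k})$ is $R_{n-k}g(E)=\int_{S^{n-1}\cap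 E} g(\theta)\,d\theta$. An origin-symmetric star body $D$ in $\mathbb{R}^n$ is a generalized $k$-intersection body, written $D\in\mathcal{BP}_k^n$, if there is a finite non-negative Borel measure $\mu_D$ on $\mathrm{Gr}_{n-k}$ such that for every $g\in C(S^{n-1})$, $\int_{S^{n-1}}\rho_D^k(\theta) g(\theta)\,d\theta=\int_{\mathrm{Gr}_{n-k}} R_{n-k}g(H)\,d\mu_D(H)$. The outer volume ratio distance from a star body $K$ to $\mathcal{BP}_k^n$ is $d_{\rm ovr}(K,\mathcal{BP}_k^n)=\inf\{(|D|/|K|)^{1/n}: K\subset D,\ D\in\mathcal{BP}_k^n\}$, and $d_{\rm ovr}^k$ denotes its $k$-th power. *)

theory Defs
  imports "HOL-Analysis.Analysis"
begin

definition star_shaped :: "'a::euclidean_space set \<Rightarrow> bool" where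
  "star_shaped K \<longleftrightarrow> compact K \<and> 0 \<in> interior K \<and>
     (\<forall>v. v \<noteq> 0 \<longrightarrow> (\<exists>a b. K \<inter> span {v} = closed_segment a b))"

definition radial_fun :: "'a::euclidean_space set \<Rightarrow> 'a \<Rightarrow> real" where
  "radial_fun K \<theta> = (GREATEST t. 0 < t \<and> t *\<^sub>R \<theta> \<in> K)"

definition star_body :: "'a::euclidean_space set \<Rightarrow> bool" where
  "star_body K \<longleftrightarrow> star_shaped K \<and> continuous_on (sphere 0 1) (radial_fun K)"

definition origin_symmetric :: "'a::euclidean_space set \<Rightarrow> bool" where
  "origin_symmetric K \<longleftrightarrow> K = uminus ` K"

definition orthonormal_basis_of :: "'a::euclidean_space set \<Rightarrow> 'a set \<Rightarrow> bool" where
  "orthonormal_basis_of E B \<longleftrightarrow> pairwise orthogonal B \<and> (\<forall>b\<in>B. norm b = 1) \<and> span B = E"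

text \<open>
  Lebesgue measure of dimension \<open>dim E\<close> on a linear subspace \<open>E\<close>: the product measure on
  the coordinates with respect to an orthonormal basis of \<open>E\<close>. The result does not depend on
  the basis chosen.
\<close>

definition subspace_lborel :: "'a::euclidean_space set \<Rightarrow> 'a measure" where
  "subspace_lborel E =
     (let B = (SOME B. orthonormal_basis_of E B) in
      distr (\<Pi>\<^sub>M b\<in>B. (lborel :: real measure)) (restrict_space borel E)
        (\<lambda>x. \<Sum>b\<in>B. x b *\<^sub>R b))"

text \<open>
  Non-normalized surface measure on the unit sphere of an \<open>m\<close>-dimensional subspace \<open>E\<close>:
  the measure of \<open>A\<close> is \<open>m\<close> times the \<open>m\<close>-dimensional volume of the cone of all
  \<open>t *\<^sub>R \<theta>\<close> with \<open>\<theta> \<in> A\<close> and \<open>0 < t < 1\<close>, this cone being the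
  preimage of \<open>A\<close> under \<open>sgn x = x /\<^sub>R norm x\<close> in the punctured open unit ball. The total
  mass is \<open>m\<close> times the volume of the unit ball, and for \<open>m = 1\<close> this is counting measure on
  the two points of the sphere. The space of the measure is the sphere itself, so that
  functions continuous on the sphere only are measurable.
\<close>

definition sphere_measure :: "'a::euclidean_space set \<Rightarrow> 'a measure" where
  "sphere_measure E =
     scale_measure (of_nat (dim E))
       (distr (restrict_space (subspace_lborel E) (ball 0 1 - {0}))
              (restrict_space borel (sphere 0 1 \<inter> E)) sgn)"

definition Gr :: "nat \<Rightarrow> 'a::euclidean_space set set" where
  "Gr m = {E. subspace E \<and> dim E = m}"

text \<open>
  The usual topology of the Grassmannian is induced by the operator norm distance of the
  orthogonal projections; for a subspace \<open>E\<close>, \<open>closest_point E\<close> is the orthogonal projection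
  onto \<open>E\<close>.
\<close>

definition gap_dist :: "'a::euclidean_space set \<Rightarrow> 'a set \<Rightarrow> real" where
  "gap_dist E F = onorm (\<lambda>x. closest_point E x - closest_point F x)"

definition Gr_borel :: "nat \<Rightarrow> 'a::euclidean_space set measure" where
  "Gr_borel m = sigma (Gr m) {U. openin (Metric_space.mtopology (Gr m) gap_dist) U}"

definition spherical_radon :: "('a::euclidean_space \<Rightarrow> real) \<Rightarrow> 'a set \<Rightarrow> real" where
  "spherical_radon g E = (LINT \<theta>|sphere_measure E. g \<theta>)"

definition BP :: "nat \<Rightarrow> 'a::euclidean_space set set" where
  "BP k = {D. star_body D \<and> origin_symmetric D \<and>
     (\<exists>\<mu>. sets \<mu> = sets (Gr_borel (DIM('a) - k)) \<and> finite_measure \<mu> \<and>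
        (\<forall>g. continuous_on (sphere 0 1) g \<longrightarrow>
           (LINT \<theta>|sphere_measure UNIV. radial_fun D \<theta> ^ k * g \<theta>) =
           (LINT H|\<mu>. spherical_radon g H)))}"

text \<open>
  The infimum is taken in the extended non-negative reals, so it is \<open>\<infinity>\<close> if no member of the
  class contains \<open>K\<close>.
\<close>

definition d_ovr :: "'a::euclidean_space set \<Rightarrow> 'a set set \<Rightarrow> ennreal" where
  "d_ovr K \<C> =
     (INF D\<in>{D\<in>\<C>. K \<subseteq> D}.
        ennreal ((measure lebesgue D / measure lebesgue K) powr (1 / real DIM('a))))"

end

theory Submission
  imports Defs
begin

text \<open>
  Put \<open>g(\<theta>) = \<rho>\<^sub>K\<^bsup>n-k-1\<^esup>(\<theta>) f(\<rho>\<^sub>K(\<theta>) \<theta>)\<close> and let \<open>M\<close> be the maximum of its Radon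
  transform. For \<open>D \<supseteq> K\<close> in the class, \<open>\<integral> \<rho>\<^sub>K\<^sup>k g \<le> \<integral> \<rho>\<^sub>D\<^sup>k g = \<integral> R g d\<mu>\<^sub>D \<le> M \<mu>\<^sub>D(Gr)\<close>. Taking \<open>g = 1\<close> in
  the defining identity gives \<open>\<mu>\<^sub>D(Gr) (n-k) \<omega>\<^bsub>n-k\<^esub> = \<integral> \<rho>\<^sub>D\<^sup>k\<close>, which Hoelder's inequality and the polar formula
  for the volume bound by \<open>n \<omega>\<^sub>n\<^bsup>(n-k)/n\<^esup> |D|\<^bsup>k/n\<^esup>\<close>. Minimise over \<open>D\<close>.

  If no such \<open>D\<close> existed, the infimum would be infinite, and only the case \<open>M = 0\<close> would need
  an argument: then \<open>g = 0\<close>, because every direction lies in some \<open>(n-k)\<close>-dimensional subspace.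
\<close>

section \<open>Orthonormal families and their coordinates\<close>

text \<open>Families are used rather than sets: a basis can be indexed by itself, while the index
  set \<open>{..<m}\<close> is common to all subspaces of dimension \<open>m\<close>.\<close>

definition orthonormal_family :: "'i set \<Rightarrow> ('i \<Rightarrow> 'a::real_inner) \<Rightarrow> bool" where
  "orthonormal_family I b \<longleftrightarrow> (\<forall>i\<in>I. \<forall>j\<in>I. b i \<bullet> b j = (if i = j then 1 else 0))"

definition lincomb :: "'i set \<Rightarrow> ('i \<Rightarrow> 'a::real_vector) \<Rightarrow> ('i \<Rightarrow> real) \<Rightarrow> 'a" where
  "lincomb I b x = (\<Sum>i\<in>I. x i *\<^sub>R b i)"

abbreviation lborel_PiM :: "'i set \<Rightarrow> ('i \<Rightarrow> real) measure" where
  "lborel_PiM I \<equiv> Pi\<^sub>M I (\<lambda>_. lborel)"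

interpretation lborel_product: product_sigma_finite "\<lambda>_. lborel :: real measure" ..

lemma lincomb_measurable [measurable]:
  fixes b :: "'i \<Rightarrow> 'a::euclidean_space"
  shows "lincomb I b \<in> borel_measurable (lborel_PiM I)"
  unfolding lincomb_def by measurable

lemma lincomb_in_span: "lincomb I b x \<in> span (b ` I)"
  unfolding lincomb_def by (intro span_sum span_mul span_base) auto

lemma lincomb_surj:
  assumes "finite I" "v \<in> span (b ` I)"
  obtains t where "v = lincomb I b t"
proof -
  from assms(2) have "\<exists>t. v = lincomb I b t"
  proof (induction rule: span_induct_alt)
    case base
    show ?case by (intro exI[of _ "\<lambda>_. 0"]) (simp add: lincomb_def)
  next
    case (step c x y)
    then obtain i t where it: "i \<in> I" "x = b i" "y = lincomb I b t" by auto
    have "c *\<^sub>R x + y = lincomb I b (\<lambda>j. t j + (if j = i then c else 0))"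
      using it assms(1) by (simp add: lincomb_def scaleR_add_left sum.distrib if_distrib[of "\<lambda>r. r *\<^sub>R _"] cong: if_cong)
    then show ?case by blast
  qed
  then show thesis using that by blast
qed

lemma inner_lincomb:
  assumes "finite I" "orthonormal_family I b" "j \<in> I"
  shows "lincomb I b x \<bullet> b j = x j"
proof -
  have "lincomb I b x \<bullet> b j = (\<Sum>i\<in>I. x i * (if i = j then 1 else 0))"
    unfolding lincomb_def inner_sum_left inner_scaleR_left
    using assms by (intro sum.cong) (auto simp: orthonormal_family_def)
  then show ?thesis using assms by (simp add: if_distrib[of "\<lambda>r. _ * r"] cong: if_cong)
qed

lemma norm_lincomb:
  assumes "finite I" "orthonormal_family I b"
  shows "norm (lincomb I b x) = sqrt (\<Sum>i\<in>I. (x i)\<^sup>2)"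
proof -
  have "lincomb I b x \<bullet> lincomb I b x = (\<Sum>j\<in>I. x j * (lincomb I b x \<bullet> b j))"
    by (subst (2) lincomb_def) (simp add: inner_sum_right)
  also have "\<dots> = (\<Sum>i\<in>I. (x i)\<^sup>2)"
    by (intro sum.cong) (auto simp: inner_lincomb[OF assms] power2_eq_square)
  finally show ?thesis by (simp add: norm_eq_sqrt_inner)
qed

lemma orthonormal_family_inj: "orthonormal_family I b \<Longrightarrow> inj_on b I"
  by (auto simp: inj_on_def orthonormal_family_def) (metis zero_neq_one)

lemma dim_span_orthonormal_family:
  fixes b :: "'i \<Rightarrow> 'a::euclidean_space"
  assumes "orthonormal_family I b"
  shows "dim (span (b ` I)) = card I"
proof -
  have "independent (b ` I)"
  proof (rule pairwise_orthogonal_independent)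
    show "pairwise orthogonal (b ` I)"
      using assms by (auto simp: pairwise_def orthonormal_family_def orthogonal_def)
    show "0 \<notin> b ` I"
      using assms by (auto simp: orthonormal_family_def) (metis inner_zero_left zero_neq_one)
  qed
  then have "dim (span (b ` I)) = card (b ` I)"
    by (simp add: dim_eq_card_independent)
  then show ?thesis using card_image[OF orthonormal_family_inj[OF assms]] by simp
qed

text \<open>Regards a basis given as a set as a family indexed by itself; this is how the basis
  chosen inside \<open>subspace_lborel\<close> enters the results on families.\<close>

lemma orthonormal_basis_of_imp_family:
  assumes "orthonormal_basis_of E B"
  shows "finite (B :: 'a::euclidean_space set)" "orthonormal_family B (\<lambda>x. x)" "span ((\<lambda>x. x) ` B) = E"
proof -
  show B: "orthonormal_family B (\<lambda>x. x)"
    using assms by (auto simp: orthonormal_family_def orthonormal_basis_of_def pairwise_def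
        orthogonal_def norm_eq_1)
  have "independent B"
    using assms by (intro pairwise_orthogonal_independent) (auto simp: orthonormal_basis_of_def)
  then show "finite B" by (rule finiteI_independent)
  show "span ((\<lambda>x. x) ` B) = E" using assms by (simp add: orthonormal_basis_of_def)
qed

subsection \<open>Lebesgue measure in orthonormal coordinates\<close>

text \<open>A product measure is determined by its values on boxes, and on a box the claim splits
  into the translation invariance of \<open>lborel\<close> on each factor.\<close>

lemma distr_lborel_PiM_translation:
  assumes "finite I"
  shows "distr (lborel_PiM I) (lborel_PiM I) (\<lambda>x. \<lambda>i\<in>I. x i + t i) = lborel_PiM I"
proof (rule lborel_product.PiM_eqI[OF assms])
  show "sets (distr (lborel_PiM I) (lborel_PiM I) (\<lambda>x. \<lambda>i\<in>I. x i + t i)) = sets (lborel_PiM I)"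
    by simp
next
  fix A :: "'a \<Rightarrow> real set" assume A: "\<And>i. i \<in> I \<Longrightarrow> A i \<in> sets lborel"
  let ?A = "\<lambda>i. (\<lambda>x. x + t i) -` A i"
  have A': "?A i \<in> sets lborel" if "i \<in> I" for i
    using measurable_sets_borel[of "\<lambda>x. x + t i" borel "A i"] A[OF that] by simp
  have "emeasure (distr (lborel_PiM I) (lborel_PiM I) (\<lambda>x. \<lambda>i\<in>I. x i + t i)) (Pi\<^sub>E I A)
      = emeasure (lborel_PiM I) ((\<lambda>x. \<lambda>i\<in>I. x i + t i) -` Pi\<^sub>E I A \<inter> space (lborel_PiM I))"
    using A assms by (intro emeasure_distr sets_PiM_I_finite) auto
  also have "(\<lambda>x. \<lambda>i\<in>I. x i + t i) -` Pi\<^sub>E I A \<inter> space (lborel_PiM I) = Pi\<^sub>E I ?A"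
    by (auto simp: space_PiM PiE_def Pi_def)
  also have "emeasure (lborel_PiM I) \<dots> = (\<Prod>i\<in>I. emeasure lborel (?A i))"
    using A' assms by (intro lborel_product.emeasure_PiM) auto
  also have "\<dots> = (\<Prod>i\<in>I. emeasure lborel (A i))"
  proof (intro prod.cong refl)
    fix i assume i: "i \<in> I"
    have "emeasure lborel (A i) = emeasure (distr lborel borel ((+) (t i))) (A i)"
      by (simp add: lborel_distr_plus)
    also have "\<dots> = emeasure lborel (?A i)"
      using A[OF i] by (subst emeasure_distr) (auto simp: add.commute vimage_def)
    finally show "emeasure lborel (?A i) = emeasure lborel (A i)" by simp
  qed
  finally show "emeasure (distr (lborel_PiM I) (lborel_PiM I) (\<lambda>x. \<lambda>i\<in>I. x i + t i)) (Pi\<^sub>E I A)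
      = (\<Prod>i\<in>I. emeasure lborel (A i))" .
qed

text \<open>A vector \<open>v\<close> of the span is itself a combination with coefficients
  \<open>t\<close>, so translating by \<open>v\<close> in the subspace amounts to translating the
  coordinates by \<open>t\<close>.\<close>

lemma nn_integral_lincomb_translation:
  fixes b :: "'i \<Rightarrow> 'a::euclidean_space"
  assumes "finite I" "v \<in> span (b ` I)" and [measurable]: "h \<in> borel_measurable borel"
  shows "(\<integral>\<^sup>+x. h (lincomb I b x + v) \<partial>lborel_PiM I) = (\<integral>\<^sup>+x. h (lincomb I b x) \<partial>lborel_PiM I)"
proof -
  obtain t where t: "v = lincomb I b t" using lincomb_surj[OF assms(1,2)] .
  have "(\<integral>\<^sup>+x. h (lincomb I b x) \<partial>lborel_PiM I)
      = (\<integral>\<^sup>+x. h (lincomb I b x) \<partial>distr (lborel_PiM I) (lborel_PiM I) (\<lambda>x. \<lambda>i\<in>I. x i + t i))"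
    by (simp add: distr_lborel_PiM_translation[OF assms(1)])
  also have "\<dots> = (\<integral>\<^sup>+x. h (lincomb I b (\<lambda>i\<in>I. x i + t i)) \<partial>lborel_PiM I)"
    by (intro nn_integral_distr) measurable
  also have "\<dots> = (\<integral>\<^sup>+x. h (lincomb I b x + v) \<partial>lborel_PiM I)"
    by (simp add: t lincomb_def scaleR_add_left sum.distrib cong: sum.cong)
  finally show ?thesis by simp
qed

text \<open>For orthonormal \<open>b\<close> this is Lebesgue measure on the span, regarded as a
  Borel measure on the whole space. Its sigma-algebra does not depend on the subspace, so the
  measures of different frames can be compared directly.\<close>

definition frame_measure :: "'i set \<Rightarrow> ('i \<Rightarrow> 'a::euclidean_space) \<Rightarrow> 'a measure" where
  "frame_measure I b = distr (lborel_PiM I) borel (lincomb I b)"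

lemma sets_frame_measure [simp, measurable_cong]: "sets (frame_measure I b) = sets borel"
  and space_frame_measure [simp]: "space (frame_measure I b) = UNIV"
  by (simp_all add: frame_measure_def)

lemma nn_integral_frame_measure:
  "h \<in> borel_measurable borel \<Longrightarrow>
    (\<integral>\<^sup>+x. h x \<partial>frame_measure I b) = (\<integral>\<^sup>+x. h (lincomb I b x) \<partial>lborel_PiM I)"
  unfolding frame_measure_def by (rule nn_integral_distr) auto

text \<open>The uniqueness argument for Haar measure, with the shear \<open>(x, y) \<mapsto> (x, x + y)\<close>: two measures
  on the same subspace that are invariant under its translations agree up to a factor and a reflection.\<close>

lemma emeasure_frame_measure_mult_eq:
  fixes b :: "'i \<Rightarrow> 'a::euclidean_space" and c :: "'j \<Rightarrow> 'a"
  assumes fin: "finite I" "finite J" and span: "span (b ` I) = span (c ` J)"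
    and [measurable]: "A \<in> sets borel" "B \<in> sets borel"
  shows "emeasure (frame_measure I b) A * emeasure (frame_measure J c) B
       = emeasure (frame_measure I b) B * emeasure (frame_measure J c) (uminus ` A)"
proof -
  let ?p = "lincomb I b" and ?q = "lincomb J c"
  interpret I: finite_product_sigma_finite "\<lambda>_. lborel :: real measure" I by standard fact
  interpret J: finite_product_sigma_finite "\<lambda>_. lborel :: real measure" J by standard fact
  interpret IJ: pair_sigma_finite "lborel_PiM I" "lborel_PiM J" ..
  have A'[measurable]: "uminus ` A \<in> sets borel"
  proof -
    have "uminus ` A = uminus -` A" by force
    then show ?thesis using measurable_sets_borel[of uminus borel A] by simp
  qed
  have fmI: "emeasure (frame_measure I b) S = (\<integral>\<^sup>+x. indicator S (?p x) \<partial>lborel_PiM I)"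
    if "S \<in> sets borel" for S
    using that nn_integral_frame_measure[of "indicator S" I b] by simp
  have fmJ: "emeasure (frame_measure J c) S = (\<integral>\<^sup>+x. indicator S (?q x) \<partial>lborel_PiM J)"
    if "S \<in> sets borel" for S
    using that nn_integral_frame_measure[of "indicator S" J c] by simp
  have px: "?p x \<in> span (c ` J)" for x using lincomb_in_span span by metis
  have qy: "- ?q y \<in> span (b ` I)" for y using lincomb_in_span[of J c] span span_neg by metis
  have "emeasure (frame_measure I b) A * emeasure (frame_measure J c) B
      = (\<integral>\<^sup>+x. indicator A (?p x) * (\<integral>\<^sup>+y. indicator B (?q y) \<partial>lborel_PiM J) \<partial>lborel_PiM I)"
    by (simp add: fmI fmJ nn_integral_multc)
  \<comment> \<open>The shear: \<open>?p x\<close> lies in the span of \<open>c\<close>, so for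
    fixed \<open>x\<close> the variable \<open>y\<close> may be translated by it.\<close>
  also have "\<dots> = (\<integral>\<^sup>+x. indicator A (?p x) * (\<integral>\<^sup>+y. indicator B (?q y + ?p x) \<partial>lborel_PiM J) \<partial>lborel_PiM I)"
    by (subst nn_integral_lincomb_translation[OF fin(2) px]) simp_all
  also have "\<dots> = (\<integral>\<^sup>+x. (\<integral>\<^sup>+y. indicator A (?p x) * indicator B (?q y + ?p x) \<partial>lborel_PiM J) \<partial>lborel_PiM I)"
    by (simp add: nn_integral_cmult)
  also have "\<dots> = (\<integral>\<^sup>+y. (\<integral>\<^sup>+x. indicator A (?p x) * indicator B (?q y + ?p x) \<partial>lborel_PiM I) \<partial>lborel_PiM J)"
    by (rule IJ.Fubini'[symmetric]) measurable
  \<comment> \<open>Translating \<open>x\<close> by \<open>- ?q y\<close> makes the factor with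
    \<open>B\<close> depend on \<open>x\<close> alone.\<close>
  also have "\<dots> = (\<integral>\<^sup>+y. (\<integral>\<^sup>+x. indicator A (?p x - ?q y) * indicator B (?p x) \<partial>lborel_PiM I) \<partial>lborel_PiM J)"
  proof -
    have "(\<integral>\<^sup>+x. indicator A (?p x) * indicator B (?q y + ?p x) \<partial>lborel_PiM I)
        = (\<integral>\<^sup>+x. indicator A (?p x - ?q y) * indicator B (?p x) \<partial>lborel_PiM I)" for y
      using nn_integral_lincomb_translation[OF fin(1) qy[of y],
          where h = "\<lambda>z. indicator A z * indicator B (?q y + z)"]
      by (simp add: algebra_simps)
    then show ?thesis by simp
  qed
  also have "\<dots> = (\<integral>\<^sup>+x. (\<integral>\<^sup>+y. indicator A (?p x - ?q y) * indicator B (?p x) \<partial>lborel_PiM J) \<partial>lborel_PiM I)"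
    by (rule IJ.Fubini') measurable
  also have "\<dots> = (\<integral>\<^sup>+x. indicator B (?p x) * (\<integral>\<^sup>+y. indicator A (?p x - ?q y) \<partial>lborel_PiM J) \<partial>lborel_PiM I)"
    by (simp add: nn_integral_cmult mult.commute)
  \<comment> \<open>Translating \<open>y\<close> by \<open>- ?p x\<close> removes \<open>x\<close>
    from the factor with \<open>A\<close>, where only the reflection of \<open>y\<close> is
    left.\<close>
  also have "\<dots> = (\<integral>\<^sup>+x. indicator B (?p x) * (\<integral>\<^sup>+y. indicator A (- ?q y) \<partial>lborel_PiM J) \<partial>lborel_PiM I)"
    using nn_integral_lincomb_translation[OF fin(2) span_neg[OF px], where h = "\<lambda>z. indicator A (- z)"]
    by simp
  also have "\<dots> = (\<integral>\<^sup>+x. indicator B (?p x) * (\<integral>\<^sup>+y. indicator (uminus ` A) (?q y) \<partial>lborel_PiM J) \<partial>lborel_PiM I)"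
  proof -
    have "indicator A (- z) = (indicator (uminus ` A) z :: ennreal)" for z :: 'a
      by (auto simp: indicator_def image_iff)
    then show ?thesis by simp
  qed
  also have "\<dots> = emeasure (frame_measure I b) B * emeasure (frame_measure J c) (uminus ` A)"
    by (simp add: fmI fmJ nn_integral_multc)
  finally show ?thesis .
qed

text \<open>Orthonormality turns the norm into the Euclidean norm of the coordinates, so the
  preimage is the coordinate ball of \<open>emeasure_cball_aux\<close>.\<close>

lemma emeasure_frame_measure_cball:
  assumes "finite I" "orthonormal_family I b" "r > 0"
  shows "emeasure (frame_measure I b) (cball 0 r) = ennreal (unit_ball_vol (real (card I)) * r ^ card I)"
proof -
  have "emeasure (frame_measure I b) (cball 0 r)
      = emeasure (lborel_PiM I) (lincomb I b -` cball 0 r \<inter> space (lborel_PiM I))"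
    unfolding frame_measure_def by (rule emeasure_distr) auto
  also have "lincomb I b -` cball 0 r = {f. sqrt (\<Sum>i\<in>I. (f i)\<^sup>2) \<le> r}"
    by (auto simp: norm_lincomb[OF assms(1,2)])
  finally show ?thesis by (simp only: emeasure_cball_aux[OF assms(1,3)])
qed

text \<open>The product identity is used with the symmetric set \<open>cball 0 1\<close>, whose
  measure depends on the dimension only and is positive and finite. Cancelling it compares the first
  measure with the reflection of the second; the same identity with \<open>c\<close> on both sides
  removes the reflection.\<close>

lemma frame_measure_eqI:
  fixes b :: "'i \<Rightarrow> 'a::euclidean_space" and c :: "'j \<Rightarrow> 'a"
  assumes I: "finite I" "orthonormal_family I b" and J: "finite J" "orthonormal_family J c"
    and span: "span (b ` I) = span (c ` J)"
  shows "frame_measure I b = frame_measure J c"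
proof (rule measure_eqI)
  fix A assume "A \<in> sets (frame_measure I b)"
  then have A: "A \<in> sets borel" by simp
  let ?w = "ennreal (unit_ball_vol (real (card I)))"
  have w: "?w \<noteq> 0" "?w \<noteq> top" by (auto simp: ennreal_eq_0_iff not_le)
  have card: "card I = card J"
    using dim_span_orthonormal_family[OF I(2)] dim_span_orthonormal_family[OF J(2)] span by simp
  have I1: "emeasure (frame_measure I b) (cball 0 1) = ?w"
    using emeasure_frame_measure_cball[OF I, of 1] by simp
  have J1: "emeasure (frame_measure J c) (cball 0 1) = ?w"
    using emeasure_frame_measure_cball[OF J, of 1] card by simp
  have *: "emeasure (frame_measure I b) A = emeasure (frame_measure J c) (uminus ` A)"
    using emeasure_frame_measure_mult_eq[OF I(1) J(1) span A, of "cball 0 1"] w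
    by (simp add: I1 J1 mult.commute[of _ ?w] ennreal_mult_cancel_left)
  have **: "emeasure (frame_measure J c) A = emeasure (frame_measure J c) (uminus ` A)"
    using emeasure_frame_measure_mult_eq[OF J(1) J(1) refl A, of "cball 0 1" c] w
    by (simp add: J1 mult.commute[of _ ?w] ennreal_mult_cancel_left)
  show "emeasure (frame_measure I b) A = emeasure (frame_measure J c) A"
    using * ** by simp
qed simp

lemma orthonormal_family_Basis: "orthonormal_family Basis (\<lambda>x :: 'a::euclidean_space. x)"
  by (auto simp: orthonormal_family_def inner_Basis)

lemma lborel_eq_frame_measure: "(lborel :: 'a::euclidean_space measure) = frame_measure Basis (\<lambda>x. x)"
  unfolding frame_measure_def lincomb_def[abs_def] by (rule lborel_eq)

subsection \<open>Integration over spheres of subspaces\<close>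

lemma ex_orthonormal_basis_of:
  assumes "subspace (E :: 'a::euclidean_space set)"
  shows "\<exists>B. orthonormal_basis_of E B"
  using orthonormal_basis_subspace[OF assms] unfolding orthonormal_basis_of_def by metis

text \<open>Constant along rays and cut off to the punctured open unit ball: the function whose
  integral over a subspace, times the dimension, is the integral of \<open>f\<close> against
  \<open>sphere_measure\<close>.\<close>

definition cone_extension :: "('a::euclidean_space \<Rightarrow> real) \<Rightarrow> 'a \<Rightarrow> real" where
  "cone_extension f x = indicator (ball 0 1 - {0}) x * f (sgn x)"

lemma continuous_on_sgn_compose:
  fixes f :: "'a::real_normed_vector \<Rightarrow> 'b::topological_space"
  assumes "continuous_on (sphere 0 1) f" "0 \<notin> S"
  shows "continuous_on S (\<lambda>x. f (sgn x))"
  using assms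
  by (intro continuous_on_compose2[OF assms(1)] continuous_on_sgn continuous_on_id) (auto simp: norm_sgn)

lemma cone_extension_measurable [measurable]:
  assumes "continuous_on (sphere 0 1) f"
  shows "cone_extension f \<in> borel_measurable borel"
proof -
  have "(\<lambda>x. indicator (ball 0 1 - {0}) x *\<^sub>R f (sgn x)) \<in> borel_measurable borel"
    using assms by (intro borel_measurable_continuous_on_indicator continuous_on_sgn_compose) auto
  then show ?thesis by (simp add: cone_extension_def[abs_def])
qed

lemma scale_measure_of_nat: "scale_measure (of_nat m) M = density M (\<lambda>_. ennreal (real m))"
  by (rule measure_eqI) (simp_all add: emeasure_density_const ennreal_of_nat_eq_real_of_nat)

text \<open>Unfolding the definitions leads to an integral in the coordinates of the basis picked by
  \<open>SOME\<close>; \<open>frame_measure_eqI\<close> then replaces that basis by an arbitrary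
  orthonormal family spanning \<open>E\<close>.\<close>

theorem integral_sphere_measure:
  fixes b :: "'i \<Rightarrow> 'a::euclidean_space"
  assumes I: "finite I" "orthonormal_family I b" "span (b ` I) = E"
    and f: "continuous_on (sphere 0 1) f"
  shows "(LINT \<theta>|sphere_measure E. f \<theta>) = real (card I) * (LINT x|frame_measure I b. cone_extension f x)"
proof -
  have E: "subspace E" using subspace_span[of "b ` I"] I(3) by simp
  define B where "B = (SOME B. orthonormal_basis_of E B)"
  have B: "orthonormal_basis_of E B"
    unfolding B_def by (rule someI_ex[OF ex_orthonormal_basis_of[OF E]])
  note B' = orthonormal_basis_of_imp_family[OF B]
  have N: "subspace_lborel E = distr (lborel_PiM B) (restrict_space borel E) (lincomb B (\<lambda>x. x))"
    unfolding subspace_lborel_def B_def[symmetric] Let_def lincomb_def[abs_def] ..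
  have setsN [measurable_cong]: "sets (subspace_lborel E) = sets (restrict_space borel E)"
    and spaceN [simp]: "space (subspace_lborel E) = E"
    by (simp_all add: N space_restrict_space)
  have lin: "lincomb B (\<lambda>x. x) \<in> lborel_PiM B \<rightarrow>\<^sub>M restrict_space borel E"
    using lincomb_in_span[of B "\<lambda>x. x"] B'(3) by (intro measurable_restrict_space2) auto
  let ?P = "ball 0 1 - {0} :: 'a set"
  let ?N = "restrict_space (subspace_lborel E) ?P"
  let ?S = "restrict_space borel (sphere 0 1 \<inter> E) :: 'a measure"
  have P: "?P \<inter> E \<in> sets (subspace_lborel E)"
    unfolding setsN sets_restrict_space by (intro image_eqI[of _ _ ?P]) auto
  have sgn: "sgn \<in> ?N \<rightarrow>\<^sub>M ?S"
  proof (rule measurable_restrict_space2)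
    show "sgn \<in> space ?N \<rightarrow> sphere 0 1 \<inter> E"
    proof
      fix x assume "x \<in> space ?N"
      then have x: "x \<in> E" "x \<noteq> 0" by (simp_all add: space_restrict_space)
      have "sgn x \<in> E" unfolding sgn_div_norm using E x(1) by (rule subspace_scale)
      then show "sgn x \<in> sphere 0 1 \<inter> E" using x(2) by (simp add: norm_sgn)
    qed
    have "sgn \<in> borel_measurable (borel :: 'a measure)" by measurable
    then have "sgn \<in> borel_measurable (restrict_space borel E)"
      by (rule measurable_restrict_space1)
    then have "sgn \<in> borel_measurable (subspace_lborel E)"
      by (simp only: measurable_cong_sets[OF setsN refl])
    then show "sgn \<in> borel_measurable ?N"
      by (rule measurable_restrict_space1)
  qed
  have f': "f \<in> borel_measurable ?S"
    by (intro borel_measurable_continuous_on_restrict continuous_on_subset[OF f]) simp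
  have "(LINT \<theta>|sphere_measure E. f \<theta>) = real (dim E) * (LINT \<theta>|distr ?N ?S sgn. f \<theta>)"
    unfolding sphere_measure_def scale_measure_of_nat
    using f' by (subst integral_density) simp_all
  also have "(LINT \<theta>|distr ?N ?S sgn. f \<theta>) = (LINT x|?N. f (sgn x))"
    by (rule integral_distr[OF sgn f'])
  also have "\<dots> = (LINT x|subspace_lborel E. cone_extension f x)"
    using P by (subst integral_restrict_space) (auto simp: cone_extension_def[abs_def])
  also have "\<dots> = (LINT x|lborel_PiM B. cone_extension f (lincomb B (\<lambda>x. x) x))"
    unfolding N using f by (intro integral_distr lin measurable_restrict_space1) measurable
  also have "\<dots> = (LINT x|frame_measure B (\<lambda>x. x). cone_extension f x)"
    unfolding frame_measure_def using f by (subst integral_distr) auto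
  also have "frame_measure B (\<lambda>x. x) = frame_measure I b"
    using B' I by (intro frame_measure_eqI) auto
  also have "dim E = card I"
    using dim_span_orthonormal_family[OF I(2)] I(3) by simp
  finally show ?thesis .
qed

corollary integral_sphere_measure_UNIV:
  fixes f :: "'a::euclidean_space \<Rightarrow> real"
  assumes "continuous_on (sphere 0 1) f"
  shows "(LINT \<theta>|sphere_measure UNIV. f \<theta>) = real DIM('a) * (LINT x|lborel. cone_extension f x)"
  using integral_sphere_measure[OF finite_Basis orthonormal_family_Basis _ assms]
  by (simp add: lborel_eq_frame_measure)

text \<open>Follows from the measures of closed balls alone: those of radius tending to 0 show that
  the origin is null, those of radius tending to 1 exhaust the open ball. A nonempty
  \<open>I\<close> matters, since in dimension 0 the origin carries mass 1.\<close>

lemma emeasure_frame_measure_punctured_ball: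
  fixes b :: "'i \<Rightarrow> 'a::euclidean_space"
  assumes I: "finite I" "orthonormal_family I b" and "I \<noteq> {}"
  shows "emeasure (frame_measure I b) (ball 0 1 - {0}) = ennreal (unit_ball_vol (real (card I)))"
proof -
  let ?M = "frame_measure I b" and ?w = "unit_ball_vol (real (card I))"
  have m: "card I > 0" using assms by (simp add: card_gt_0_iff)
  have fin: "emeasure ?M (cball 0 1) = ennreal ?w"
    using emeasure_frame_measure_cball[OF I, of 1] by simp
  have fin': "emeasure ?M S < top" if "S \<subseteq> cball 0 1" for S
    using emeasure_mono[OF that, of ?M] fin by (auto intro: le_less_trans)
  have cb: "measure ?M (cball 0 r) = ?w * r ^ card I" if "r > 0" for r
    using emeasure_frame_measure_cball[OF I that] that by (simp add: measure_def)
  have "emeasure ?M {0} = 0"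
  proof -
    have "measure ?M {0} \<le> ?w * r ^ card I" if "r > 0" "r < 1" for r
    proof -
      have "emeasure ?M (cball 0 r) < top" using that by (intro fin') auto
      then have "measure ?M {0} \<le> measure ?M (cball 0 r)"
        using that by (intro measure_mono_fmeasurable) (auto simp: fmeasurable_def)
      then show ?thesis using cb that by simp
    qed
    then have ev: "\<forall>\<^sub>F r in at_right 0. measure ?M {0} \<le> ?w * r ^ card I"
      unfolding eventually_at_right_field by (intro exI[of _ 1]) auto
    have "((\<lambda>r. ?w * r ^ card I) \<longlongrightarrow> ?w * 0 ^ card I) (at_right 0)"
      by (intro tendsto_intros)
    from tendsto_lowerbound[OF this ev] have "measure ?M {0} \<le> 0" using m by (simp add: power_0_left)
    moreover have "emeasure ?M {0} < top" by (intro fin') auto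
    ultimately show ?thesis
      using emeasure_eq_ennreal_measure[of ?M "{0}"] by (auto simp: measure_le_0_iff)
  qed
  then have "emeasure ?M (ball 0 1 - {0}) = emeasure ?M (ball 0 1)"
    by (intro emeasure_Diff_null_set) (auto simp: null_sets_def)
  also have "\<dots> = ennreal ?w"
  proof (rule antisym)
    show "emeasure ?M (ball 0 1) \<le> ennreal ?w"
      using fin emeasure_mono[OF ball_subset_cball[of 0 1], of ?M] by simp
    have "?w * r ^ card I \<le> measure ?M (ball 0 1)" if "r > 0" "r < 1" for r
    proof -
      have "emeasure ?M (ball 0 1) < top" by (intro fin') auto
      then have "measure ?M (cball 0 r) \<le> measure ?M (ball 0 1)"
        using that by (intro measure_mono_fmeasurable) (auto simp: fmeasurable_def)
      then show ?thesis using cb that by simp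
    qed
    then have ev: "\<forall>\<^sub>F r in at_left 1. ?w * r ^ card I \<le> measure ?M (ball 0 1)"
      unfolding eventually_at_left_field by (intro exI[of _ 0]) auto
    have "((\<lambda>r. ?w * r ^ card I) \<longlongrightarrow> ?w * 1 ^ card I) (at_left 1)"
      by (intro tendsto_intros)
    from tendsto_upperbound[OF this ev] have "?w \<le> measure ?M (ball 0 1)" by simp
    moreover have "emeasure ?M (ball 0 1) = ennreal (measure ?M (ball 0 1))"
      using fin'[of "ball 0 1"] by (intro emeasure_eq_ennreal_measure) auto
    ultimately show "ennreal ?w \<le> emeasure ?M (ball 0 1)"
      using ennreal_leI by metis
  qed
  finally show ?thesis .
qed

lemma measure_frame_measure_punctured_ball:
  fixes b :: "'i \<Rightarrow> 'a::euclidean_space"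
  assumes I: "finite I" "orthonormal_family I b" and "I \<noteq> {}"
  shows "measure (frame_measure I b) (ball 0 1 - {0}) = unit_ball_vol (real (card I))"
  using emeasure_frame_measure_punctured_ball[OF assms] by (simp add: measure_def)

lemma continuous_on_sphere_bounded:
  fixes f :: "'a::euclidean_space \<Rightarrow> real"
  assumes "continuous_on (sphere 0 1) f"
  shows "\<exists>C. \<forall>x. norm x = 1 \<longrightarrow> \<bar>f x\<bar> \<le> C"
proof -
  have "bounded (f ` sphere 0 1)"
    using assms by (intro compact_imp_bounded compact_continuous_image) auto
  then obtain C where "\<forall>y\<in>f ` sphere 0 1. norm y \<le> C"
    unfolding bounded_iff by blast
  then have "\<forall>x. norm x = 1 \<longrightarrow> \<bar>f x\<bar> \<le> C" by auto
  then show ?thesis by blast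
qed

text \<open>The extension is bounded, because the sphere is compact, and vanishes off a set of
  finite measure.\<close>

lemma integrable_cone_extension:
  fixes b :: "'i \<Rightarrow> 'a::euclidean_space"
  assumes I: "finite I" "orthonormal_family I b" "I \<noteq> {}"
    and f: "continuous_on (sphere 0 1) f"
  shows "integrable (frame_measure I b) (cone_extension f)"
proof -
  obtain C where C: "\<And>x. norm x = 1 \<Longrightarrow> \<bar>f x\<bar> \<le> C"
    using continuous_on_sphere_bounded[OF f] by blast
  have "emeasure (frame_measure I b) (ball 0 1 - {0}) < top"
    using emeasure_frame_measure_punctured_ball[OF I] by simp
  then have *: "integrable (frame_measure I b) (\<lambda>x. C * indicator (ball 0 1 - {0}) x)"
    by (intro integrable_mult_right integrable_real_indicator) auto
  have "\<bar>cone_extension f x\<bar> \<le> \<bar>C * indicator (ball 0 1 - {0}) x\<bar>" for x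
    using C[of "sgn x"] by (auto simp: cone_extension_def indicator_def norm_sgn)
  then show ?thesis
    using f by (intro Bochner_Integration.integrable_bound[OF *]) auto
qed

lemma Gr_orthonormal_family:
  fixes E :: "'a::euclidean_space set"
  assumes "E \<in> Gr m"
  obtains B where "finite B" "orthonormal_family B (\<lambda>x :: 'a. x)" "span ((\<lambda>x. x) ` B) = E" "card B = m"
proof -
  have E: "subspace E" "dim E = m" using assms by (simp_all add: Gr_def)
  obtain B where "orthonormal_basis_of E B" using ex_orthonormal_basis_of[OF E(1)] by blast
  note B = orthonormal_basis_of_imp_family[OF this]
  have "card B = m"
    using dim_span_orthonormal_family[OF B(2), unfolded B(3)] E by simp
  with B show thesis by (rule that)
qed

lemma integral_cone_extension_const:
  fixes b :: "'i \<Rightarrow> 'a::euclidean_space"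
  assumes "finite I" "orthonormal_family I b" "I \<noteq> {}"
  shows "(LINT x|frame_measure I b. cone_extension (\<lambda>_. c) x) = c * unit_ball_vol (real (card I))"
proof -
  have "(\<lambda>x :: 'a. cone_extension (\<lambda>_. c) x) = (\<lambda>x. c * indicator (ball 0 1 - {0}) x)"
    by (rule ext) (simp only: cone_extension_def mult.commute)
  then show ?thesis using measure_frame_measure_punctured_ball[OF assms] by simp
qed

text \<open>With \<open>c = 1\<close> and dimension \<open>n - k\<close> this is the Radon transform
  of the constant 1, the source of the denominator in the final constant.\<close>

lemma integral_sphere_measure_const:
  fixes E :: "'a::euclidean_space set"
  assumes "E \<in> Gr m" "m \<ge> 1"
  shows "(LINT \<theta>|sphere_measure E. c) = c * (real m * unit_ball_vol (real m))"
proof -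
  obtain B where B: "finite B" "orthonormal_family B (\<lambda>x :: 'a. x)" "span ((\<lambda>x. x) ` B) = E" "card B = m"
    using assms(1) by (rule Gr_orthonormal_family)
  have "B \<noteq> {}" using B(4) assms(2) by auto
  have "(LINT \<theta>|sphere_measure E. c) = real (card B) * (LINT x|frame_measure B (\<lambda>x. x). cone_extension (\<lambda>_. c) x)"
    by (intro integral_sphere_measure B continuous_on_const)
  also have "\<dots> = real (card B) * (c * unit_ball_vol (real (card B)))"
    by (simp only: integral_cone_extension_const[OF B(1,2) \<open>B \<noteq> {}\<close>])
  finally show ?thesis by (simp add: B(4))
qed

subsection \<open>The maximal section\<close>

text \<open>Setting the frame to 0 off \<open>{..<m}\<close> leaves no free coordinates, so that the
  frames form a compact set of functions on \<open>nat\<close>.\<close>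

lemma Gr_frame:
  fixes F :: "'a::euclidean_space set"
  assumes "F \<in> Gr m"
  obtains b :: "nat \<Rightarrow> 'a" where
    "orthonormal_family {..<m} b" "\<And>i. i \<notin> {..<m} \<Longrightarrow> b i = 0" "span (b ` {..<m}) = F"
proof -
  obtain B where B: "finite B" "orthonormal_family B (\<lambda>x :: 'a. x)" "span ((\<lambda>x. x) ` B) = F" "card B = m"
    using assms by (rule Gr_orthonormal_family)
  then obtain h where h: "bij_betw h {..<m} B"
    using ex_bij_betw_nat_finite[OF B(1)] by (auto simp: atLeast0LessThan)
  define b where "b i = (if i < m then h i else 0)" for i
  have im: "b ` {..<m} = B" using h by (auto simp: b_def bij_betw_def)
  show thesis
  proof (rule that[of b])
    show "orthonormal_family {..<m} b"
      using B(2) h by (auto simp: orthonormal_family_def b_def bij_betw_def inj_on_def)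
    show "span (b ` {..<m}) = F" using im B(3) by simp
  qed (simp add: b_def)
qed

text \<open>By Tychonoff's theorem the product of closed unit balls is compact, and the conditions
  on a frame are closed, since each involves only one or two coordinates.\<close>

lemma compact_frames:
  "compact {b :: nat \<Rightarrow> 'a::euclidean_space. orthonormal_family I b \<and> (\<forall>i. i \<notin> I \<longrightarrow> b i = 0)}"
  (is "compact ?F")
proof -
  have c: "compact (Pi\<^sub>E UNIV (\<lambda>_. cball 0 1) :: (nat \<Rightarrow> 'a) set)"
  proof -
    have "compactin (product_topology (\<lambda>_. euclidean) UNIV) (Pi\<^sub>E UNIV (\<lambda>_. cball 0 1) :: (nat \<Rightarrow> 'a) set)"
      by (simp add: compactin_PiE)
    then show ?thesis by (simp add: euclidean_product_topology)
  qed
  have cont: "continuous_on UNIV (\<lambda>b :: nat \<Rightarrow> 'a. b i)" for i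
    by (rule continuous_on_product_coordinates)
  have 1: "closed {b :: nat \<Rightarrow> 'a. b i \<bullet> b j = r}" for i j r
    by (intro closed_Collect_eq continuous_on_inner cont continuous_on_const)
  have 2: "closed {b :: nat \<Rightarrow> 'a. b i = 0}" for i
    by (intro closed_Collect_eq cont continuous_on_const)
  have "?F = (\<Inter>i\<in>I. \<Inter>j\<in>I. {b. b i \<bullet> b j = (if i = j then 1 else 0)}) \<inter> (\<Inter>i\<in>-I. {b. b i = 0})"
    by (auto simp: orthonormal_family_def)
  moreover have "closed \<dots>"
    by (intro closed_Int closed_INT ballI 1 2)
  ultimately have "closed ?F" by simp
  moreover have "?F \<subseteq> Pi\<^sub>E UNIV (\<lambda>_. cball 0 1)"
  proof
    fix b assume b: "b \<in> ?F"
    have "norm (b i) \<le> 1" for i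
      using b by (cases "i \<in> I") (auto simp: orthonormal_family_def norm_eq_sqrt_inner)
    then show "b \<in> Pi\<^sub>E UNIV (\<lambda>_. cball 0 1)" by auto
  qed
  ultimately show ?thesis using c compact_Int_closed[of "Pi\<^sub>E UNIV (\<lambda>_. cball 0 1)" ?F]
    by (simp add: Int_absorb1)
qed

lemma integral_frame_measure:
  fixes b :: "'i \<Rightarrow> 'a::euclidean_space"
  assumes "continuous_on (sphere 0 1) f"
  shows "(LINT x|frame_measure I b. cone_extension f x) = (LINT x|lborel_PiM I. cone_extension f (lincomb I b x))"
  unfolding frame_measure_def using assms by (subst integral_distr) auto

text \<open>Parametrising subspaces by orthonormal frames makes the domain of integration independent of
  the subspace, so that dominated convergence applies.\<close>

lemma continuous_on_frame_integral:
  fixes f :: "'a::euclidean_space \<Rightarrow> real" and I :: "nat set"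
  assumes I: "finite I" "I \<noteq> {}" and f: "continuous_on (sphere 0 1) f"
  shows "continuous_on {b. orthonormal_family I b}
    (\<lambda>b. LINT x|frame_measure I b. cone_extension f x)"
proof -
  obtain C where C: "\<And>x. norm x = 1 \<Longrightarrow> \<bar>f x\<bar> \<le> C"
    using continuous_on_sphere_bounded[OF f] by blast
  show ?thesis
    unfolding continuous_on_sequentially
  proof safe
    fix X :: "nat \<Rightarrow> nat \<Rightarrow> 'a" and a
    assume a: "orthonormal_family I a" and X: "\<forall>n. X n \<in> {b. orthonormal_family I b}" and lim: "X \<longlonglongrightarrow> a"
    have limi: "(\<lambda>n. X n i) \<longlonglongrightarrow> a i" for i
    proof -
      have "continuous_on UNIV (\<lambda>b :: nat \<Rightarrow> 'a. b i)"
        by (rule continuous_on_product_coordinates)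
      then have "isCont (\<lambda>b :: nat \<Rightarrow> 'a. b i) a"
        by (subst (asm) continuous_on_eq_continuous_at) auto
      from isCont_tendsto_compose[OF this lim] show ?thesis .
    qed
    \<comment> \<open>The norm depends only on the coordinates \<open>x\<close>, so the cutoff to
      the punctured ball is the same for every frame. Hence convergence has no exceptional points on
      the boundary, and the cut-off constant \<open>C\<close> for the limit frame dominates all
      terms.\<close>
    have norm: "norm (lincomb I (X n) x) = norm (lincomb I a x)" for n x
      using X a I by (simp add: norm_lincomb)
    have zero: "lincomb I (X n) x = 0 \<longleftrightarrow> lincomb I a x = 0" for n x
      using norm[of n x] by (metis norm_eq_zero)
    have "(\<lambda>n. LINT x|lborel_PiM I. cone_extension f (lincomb I (X n) x))
        \<longlonglongrightarrow> (LINT x|lborel_PiM I. cone_extension f (lincomb I a x))"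
    proof (rule integral_dominated_convergence[where w = "\<lambda>x. cone_extension (\<lambda>_. C) (lincomb I a x)"])
      have "integrable (frame_measure I a) (cone_extension (\<lambda>_. C))"
        using a I by (intro integrable_cone_extension) auto
      then show "integrable (lborel_PiM I) (\<lambda>x. cone_extension (\<lambda>_. C) (lincomb I a x))"
        unfolding frame_measure_def by (subst (asm) integrable_distr_eq) auto
      show "AE x in lborel_PiM I. (\<lambda>n. cone_extension f (lincomb I (X n) x)) \<longlonglongrightarrow> cone_extension f (lincomb I a x)"
      proof (rule AE_I2)
        fix x
        show "(\<lambda>n. cone_extension f (lincomb I (X n) x)) \<longlonglongrightarrow> cone_extension f (lincomb I a x)"
        proof (cases "lincomb I a x \<in> ball 0 1 - {0}")
          case True
          then have T: "lincomb I (X n) x \<in> ball 0 1 - {0}" for n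
            using norm zero by simp
          have "(\<lambda>n. lincomb I (X n) x) \<longlonglongrightarrow> lincomb I a x"
            unfolding lincomb_def by (intro tendsto_intros limi)
          then have "(\<lambda>n. sgn (lincomb I (X n) x)) \<longlonglongrightarrow> sgn (lincomb I a x)"
            using True by (intro tendsto_sgn) auto
          then have "(\<lambda>n. f (sgn (lincomb I (X n) x))) \<longlonglongrightarrow> f (sgn (lincomb I a x))"
            using T True by (intro continuous_on_tendsto_compose[OF f]) (auto simp: norm_sgn zero)
          then show ?thesis using T True by (simp add: cone_extension_def)
        next
          case False
          then have "lincomb I (X n) x \<notin> ball 0 1 - {0}" for n
            using norm zero by simp
          then show ?thesis using False by (simp add: cone_extension_def)
        qed
      qed
      fix n
      show "AE x in lborel_PiM I. norm (cone_extension f (lincomb I (X n) x)) \<le> cone_extension (\<lambda>_. C) (lincomb I a x)"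
        using C by (intro AE_I2) (auto simp: cone_extension_def indicator_def norm zero norm_sgn)
    qed (use f in measurable)
    then show "((\<lambda>b. LINT x|frame_measure I b. cone_extension f x) \<circ> X)
        \<longlonglongrightarrow> (LINT x|frame_measure I a. cone_extension f x)"
      using f by (simp add: integral_frame_measure o_def)
  qed
qed

text \<open>The maximum is taken over the compact set of frames, whose spans run through all of
  \<open>Gr m\<close>; the topology of the Grassmannian itself does not enter.\<close>

theorem sphere_integral_attains_max:
  fixes f :: "'a::euclidean_space \<Rightarrow> real"
  assumes m: "1 \<le> m" "m \<le> DIM('a)" and f: "continuous_on (sphere 0 1) f"
  shows "\<exists>E\<in>Gr m. \<forall>F\<in>Gr m. (LINT \<theta>|sphere_measure F. f \<theta>) \<le> (LINT \<theta>|sphere_measure E. f \<theta>)"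
proof -
  let ?I = "{..<m}"
  let ?F = "{b :: nat \<Rightarrow> 'a. orthonormal_family ?I b \<and> (\<forall>i. i \<notin> ?I \<longrightarrow> b i = 0)}"
  let ?\<Phi> = "\<lambda>b. LINT x|frame_measure ?I b. cone_extension f x"
  have sph: "(LINT \<theta>|sphere_measure (span (b ` ?I)). f \<theta>) = real m * ?\<Phi> b" if "b \<in> ?F" for b
    using that integral_sphere_measure[of ?I b _ f] f by simp
  have Gr: "span (b ` ?I) \<in> Gr m" if "b \<in> ?F" for b
    using that dim_span_orthonormal_family[of ?I b] by (simp add: Gr_def)
  have frame: "\<exists>b\<in>?F. span (b ` ?I) = F" if "F \<in> Gr m" for F
  proof -
    obtain b :: "nat \<Rightarrow> 'a" where "orthonormal_family ?I b" "\<And>i. i \<notin> ?I \<Longrightarrow> b i = 0"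
      and "span (b ` ?I) = F"
      using Gr_frame[OF \<open>F \<in> Gr m\<close>] by metis
    then show ?thesis by (intro bexI[of _ b]) simp_all
  qed
  obtain T :: "'a set" where "subspace T" "dim T = m"
    using choose_subspace_of_subspace[of m "UNIV :: 'a set"] m by auto
  then have "T \<in> Gr m" by (simp add: Gr_def)
  then have ne: "?F \<noteq> {}" using frame[of T] by blast
  have "0 \<in> ?I" using m by simp
  then have "?I \<noteq> {}" by blast
  have "continuous_on ?F ?\<Phi>"
    by (rule continuous_on_subset[OF continuous_on_frame_integral[OF finite_lessThan \<open>?I \<noteq> {}\<close> f]]) blast
  from continuous_attains_sup[OF compact_frames ne this]
  obtain b where b: "b \<in> ?F" "\<forall>c\<in>?F. ?\<Phi> c \<le> ?\<Phi> b" by blast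
  show ?thesis
  proof (intro bexI ballI)
    show "span (b ` ?I) \<in> Gr m" using Gr b by blast
    fix F :: "'a set" assume "F \<in> Gr m"
    then obtain c where c: "c \<in> ?F" "span (c ` ?I) = F" using frame by blast
    then show "(LINT \<theta>|sphere_measure F. f \<theta>) \<le> (LINT \<theta>|sphere_measure (span (b ` ?I)). f \<theta>)"
      using sph[OF c(1)] sph[OF b(1)] b(2) by (simp add: mult_left_mono)
  qed
qed

section \<open>Positivity of integrals over sections of the sphere\<close>

text \<open>Complete \<theta> to an orthonormal basis of the whole space and keep
  \<open>m - 1\<close> of the other vectors.\<close>

lemma ex_Gr_containing:
  fixes \<theta> :: "'a::euclidean_space"
  assumes "1 \<le> m" "m \<le> DIM('a)" "norm \<theta> = 1"
  obtains E where "E \<in> Gr m" "\<theta> \<in> E"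
proof -
  obtain S where S: "\<theta> \<in> S" "pairwise orthogonal S" "\<And>x. x \<in> S \<Longrightarrow> norm x = 1" "card S = DIM('a)"
    using vector_in_orthonormal_basis[OF assms(3)] by metis
  have "finite S" using S(4) by (intro card_ge_0_finite) simp
  then have "m - 1 \<le> card (S - {\<theta>})" using S assms by simp
  then obtain A where A: "A \<subseteq> S - {\<theta>}" "card A = m - 1" "finite A"
    by (rule obtain_subset_with_card_n)
  have "orthonormal_family (insert \<theta> A) (\<lambda>x. x)"
    using S A(1) by (auto simp: orthonormal_family_def pairwise_def orthogonal_def norm_eq_1 subset_iff)
  from dim_span_orthonormal_family[OF this] have "dim (span (insert \<theta> A)) = card (insert \<theta> A)"
    by simp
  moreover have "card (insert \<theta> A) = m" using A assms(1) by (subst card_insert_disjoint) auto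
  ultimately show thesis
    using that[of "span (insert \<theta> A)"] by (auto simp: Gr_def span_base)
qed

text \<open>By continuity the cone extension exceeds half of \<open>f \<theta>\<close> on a small
  ball about the midpoint of the segment from 0 to \<theta>. The centre lies in \<open>E\<close>, so
  by translation invariance this ball has the same positive measure as one about the origin.\<close>

lemma integral_sphere_measure_pos:
  fixes f :: "'a::euclidean_space \<Rightarrow> real"
  assumes E: "E \<in> Gr m" "1 \<le> m" and f: "continuous_on (sphere 0 1) f"
    and nonneg: "\<And>x. norm x = 1 \<Longrightarrow> 0 \<le> f x" and \<theta>: "\<theta> \<in> E" "norm \<theta> = 1" "0 < f \<theta>"
  shows "0 < (LINT \<theta>|sphere_measure E. f \<theta>)"
proof -
  obtain B where B: "finite B" "orthonormal_family B (\<lambda>x :: 'a. x)" "span ((\<lambda>x. x) ` B) = E"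
    and card: "card B = m"
    using E(1) by (rule Gr_orthonormal_family)
  then have "B \<noteq> {}" using E by auto
  let ?M = "frame_measure B (\<lambda>x. x)" and ?v = "(1/2) *\<^sub>R \<theta>" and ?c = "f \<theta> / 2"
  have "continuous_on (ball 0 1 - {0}) (\<lambda>x. f (sgn x))"
    using f by (rule continuous_on_sgn_compose) simp
  then have "isCont (\<lambda>x. f (sgn x)) ?v"
    using \<theta> by (subst (asm) continuous_on_eq_continuous_at) auto
  then have "((\<lambda>x. f (sgn x)) \<longlongrightarrow> f (sgn ?v)) (nhds ?v)"
    unfolding isCont_def tendsto_at_iff_tendsto_nhds[where g = "\<lambda>x. f (sgn x)" and l = ?v] .
  moreover have "f (sgn ?v) = f \<theta>" using \<theta> by (simp add: sgn_div_norm)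
  ultimately have "\<forall>\<^sub>F x in nhds ?v. ?c < f (sgn x)"
    using \<theta>(3) by (intro order_tendstoD(1)[of _ "f \<theta>"]) simp_all
  then obtain \<epsilon> where \<epsilon>: "\<epsilon> > 0" "\<And>x. dist x ?v < \<epsilon> \<Longrightarrow> ?c < f (sgn x)"
    unfolding eventually_nhds_metric by blast
  \<comment> \<open>The centre has norm 1/2, so a radius of at most 1/2 keeps the open ball inside
    the unit ball and away from the origin.\<close>
  define d where "d = min \<epsilon> (1/2)"
  have d: "d > 0" "d \<le> \<epsilon>" "d \<le> 1/2" using \<epsilon> by (auto simp: d_def)
  have sub: "ball ?v d \<subseteq> ball 0 1 - {0}"
  proof
    fix x assume "x \<in> ball ?v d"
    then have "norm (x - ?v) < 1/2" using d by (simp add: dist_norm norm_minus_commute)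
    then show "x \<in> ball 0 1 - {0}"
      using norm_triangle_sub[of x ?v] \<theta> by auto
  qed
  have lower: "?c * indicator (ball ?v d) x \<le> cone_extension f x" for x
  proof (cases "x \<in> ball ?v d")
    case True
    then have "?c < f (sgn x)" using \<epsilon>(2)[of x] d by (auto simp: dist_commute)
    moreover have "x \<in> ball 0 1 - {0}" using sub True by blast
    ultimately show ?thesis using True by (simp add: cone_extension_def)
  next
    case False
    then show ?thesis using nonneg[of "sgn x"] by (auto simp: cone_extension_def indicator_def norm_sgn)
  qed
  have v: "?v \<in> span ((\<lambda>x. x) ` B)"
    using B(3) \<theta>(1) span_scale[of \<theta> "(\<lambda>x. x) ` B" "1/2"] by simp
  have [measurable]: "ball z d \<in> sets borel" for z :: 'a
    by (rule borel_open) (rule open_ball)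
  have fm: "emeasure ?M (ball z d) = (\<integral>\<^sup>+x. indicator (ball z d) (lincomb B (\<lambda>x. x) x) \<partial>lborel_PiM B)" for z
    by (subst nn_integral_frame_measure[symmetric]) simp_all
  \<comment> \<open>Halving the radius bounds the open ball below by a closed ball, whose measure is
    known.\<close>
  have "ennreal (unit_ball_vol (real (card B)) * (d/2) ^ card B) = emeasure ?M (cball 0 (d/2))"
    using emeasure_frame_measure_cball[OF B(1,2), of "d/2"] d by simp
  also have "\<dots> \<le> emeasure ?M (ball 0 d)"
    using d by (intro emeasure_mono) auto
  also have "\<dots> = (\<integral>\<^sup>+x. indicator (ball 0 d) (lincomb B (\<lambda>x. x) x) \<partial>lborel_PiM B)"
    by (rule fm)
  also have "\<dots> = (\<integral>\<^sup>+x. indicator (ball ?v d) (lincomb B (\<lambda>x. x) x + ?v) \<partial>lborel_PiM B)"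
    by (intro nn_integral_cong) (auto simp: indicator_def dist_norm)
  also have "\<dots> = (\<integral>\<^sup>+x. indicator (ball ?v d) (lincomb B (\<lambda>x. x) x) \<partial>lborel_PiM B)"
    using nn_integral_lincomb_translation[OF B(1) v, of "indicator (ball ?v d)"] by simp
  also have "\<dots> = emeasure ?M (ball ?v d)"
    by (rule fm[symmetric])
  finally have "ennreal (unit_ball_vol (real (card B)) * (d/2) ^ card B) \<le> emeasure ?M (ball ?v d)" .
  moreover have "0 < ennreal (unit_ball_vol (real (card B)) * (d/2) ^ card B)"
    using d by simp
  ultimately have pos: "0 < emeasure ?M (ball ?v d)" by (rule less_le_trans[rotated])
  have fin: "emeasure ?M (ball ?v d) < top"
    using emeasure_mono[OF sub, of ?M] emeasure_frame_measure_punctured_ball[OF B(1,2) \<open>B \<noteq> {}\<close>]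
    by (auto intro: le_less_trans)
  have "0 < ?c * measure ?M (ball ?v d)"
    using pos fin \<theta>(3) by (simp add: measure_def enn2real_positive_iff)
  also have "\<dots> = (LINT x|?M. ?c * indicator (ball ?v d) x)" by simp
  also have "\<dots> \<le> (LINT x|?M. cone_extension f x)"
    using fin lower f \<open>B \<noteq> {}\<close>
    by (intro integral_mono integrable_mult_right integrable_real_indicator integrable_cone_extension B) auto
  finally show ?thesis
    using integral_sphere_measure[OF B f] card E by simp
qed

subsection \<open>Volume and radial function\<close>

text \<open>Compactness of \<open>D\<close> makes \<open>GREATEST\<close> an attained maximum, the
  interior origin makes it positive, and convexity of the section by a line gives the whole segment
  up to it.\<close>

lemma radial_fun_props:
  fixes D :: "'a::euclidean_space set"
  assumes D: "star_shaped D" and \<theta>: "norm \<theta> = 1"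
  shows radial_fun_pos: "0 < radial_fun D \<theta>"
    and radial_fun_mem: "radial_fun D \<theta> *\<^sub>R \<theta> \<in> D"
    and radial_fun_upper: "0 < t \<Longrightarrow> t *\<^sub>R \<theta> \<in> D \<Longrightarrow> t \<le> radial_fun D \<theta>"
    and radial_fun_segment: "0 \<le> t \<Longrightarrow> t \<le> radial_fun D \<theta> \<Longrightarrow> t *\<^sub>R \<theta> \<in> D"
proof -
  have comp: "compact D" and int: "0 \<in> interior D" using D by (auto simp: star_shaped_def)
  let ?T = "{t. 0 \<le> t \<and> t *\<^sub>R \<theta> \<in> D}"
  obtain e where e: "e > 0" "ball 0 e \<subseteq> D" using int mem_interior by metis
  have e2: "e/2 \<in> ?T" using e \<theta> by auto
  have "compact ?T"
  proof -
    obtain R where R: "\<And>x. x \<in> D \<Longrightarrow> norm x \<le> R"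
      using compact_imp_bounded[OF comp] unfolding bounded_iff by blast
    have "bounded ?T"
      unfolding bounded_iff using R \<theta> by (intro exI[of _ R]) force
    moreover have "?T = {0..} \<inter> (\<lambda>t. t *\<^sub>R \<theta>) -` D" by auto
    moreover have "closed ({0..} \<inter> (\<lambda>t. t *\<^sub>R \<theta>) -` D)"
      using compact_imp_closed[OF comp]
      by (intro closed_Int closed_vimage) (auto intro!: continuous_intros)
    ultimately show ?thesis by (simp add: compact_eq_bounded_closed)
  qed
  then obtain s where s: "s \<in> ?T" "\<forall>t\<in>?T. t \<le> s"
    using compact_attains_sup[of ?T] e2 by blast
  have "e/2 \<le> s" using s(2) e2 by blast
  then have "0 < s" using e(1) by linarith
  then have r: "radial_fun D \<theta> = s"
    unfolding radial_fun_def using s by (intro Greatest_equality) auto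
  show "0 < radial_fun D \<theta>" "radial_fun D \<theta> *\<^sub>R \<theta> \<in> D"
    "0 < t \<Longrightarrow> t *\<^sub>R \<theta> \<in> D \<Longrightarrow> t \<le> radial_fun D \<theta>"
    using \<open>0 < s\<close> s r by auto
  show "t *\<^sub>R \<theta> \<in> D" if "0 \<le> t" "t \<le> radial_fun D \<theta>"
  proof -
    have "\<theta> \<noteq> 0" using \<theta> by auto
    then obtain a b where ab: "D \<inter> span {\<theta>} = closed_segment a b"
      using D unfolding star_shaped_def by blast
    have "convex (D \<inter> span {\<theta>})" unfolding ab by (rule convex_closed_segment)
    moreover have "0 \<in> D \<inter> span {\<theta>}" using int interior_subset span_zero by blast
    moreover have "s *\<^sub>R \<theta> \<in> D \<inter> span {\<theta>}" using s by (auto intro: span_mul span_base)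
    ultimately have "(1 - t/s) *\<^sub>R 0 + (t/s) *\<^sub>R (s *\<^sub>R \<theta>) \<in> D \<inter> span {\<theta>}"
      using that r \<open>0 < s\<close> by (intro convexD) (auto simp: field_simps)
    then show ?thesis using \<open>0 < s\<close> by simp
  qed
qed

lemma radial_fun_mono:
  assumes "star_shaped K" "star_shaped D" "K \<subseteq> D" "norm \<theta> = 1"
  shows "radial_fun K \<theta> \<le> radial_fun D \<theta>"
  using assms radial_fun_pos radial_fun_mem by (intro radial_fun_upper) blast+

lemma measure_star_shaped_pos:
  fixes D :: "'a::euclidean_space set"
  assumes "star_shaped D"
  shows "0 < measure lebesgue D" "emeasure lborel D = ennreal (measure lebesgue D)"
proof -
  have D: "compact D" "0 \<in> interior D" using assms by (auto simp: star_shaped_def)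
  have "measure lebesgue D = measure lborel D" using borel_compact[OF D(1)] by simp
  moreover have *: "emeasure lborel D = ennreal (measure lborel D)"
    using emeasure_compact_finite[OF D(1)] by (simp add: emeasure_eq_ennreal_measure)
  ultimately show "emeasure lborel D = ennreal (measure lebesgue D)" by simp
  obtain e where e: "e > 0" "ball 0 e \<subseteq> D" using D mem_interior by metis
  have "0 < emeasure lborel (ball (0::'a) e)" using e by (simp add: emeasure_ball)
  also have "\<dots> \<le> emeasure lborel D"
    using e D by (intro emeasure_mono) (auto intro: borel_compact)
  finally show "0 < measure lebesgue D" using * \<open>measure lebesgue D = _\<close> by simp
qed

section \<open>Volume in polar coordinates and powers of the radial function\<close>

lemma nn_integral_lborel_scale:
  fixes h :: "'a::euclidean_space \<Rightarrow> ennreal"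
  assumes [measurable]: "h \<in> borel_measurable borel" and "s > 0"
  shows "(\<integral>\<^sup>+x. h x \<partial>lborel) = (\<integral>\<^sup>+x. ennreal ((1/s) ^ DIM('a)) * h ((1/s) *\<^sub>R x) \<partial>lborel)"
  using assms(2)
  by (subst lborel_affine[of "1/s" 0]) (auto simp: nn_integral_density nn_integral_distr)

text \<open>Integration in polar coordinates, without a polar decomposition of the measure: insert the
  weight \<open>1 = \<integral>\<^sub>0\<^bsup>1/|x|\<^esup> n |x|\<^sup>n s\<^bsup>n-1\<^esup> ds\<close>, rescale \<open>x\<close> by \<open>s\<close>, and integrate
  out \<open>s\<close> first.\<close>

lemma emeasure_radial_set:
  fixes u :: "'a::euclidean_space \<Rightarrow> real"
  assumes [measurable]: "u \<in> borel_measurable borel"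
    and pos: "\<And>x. x \<noteq> 0 \<Longrightarrow> 0 < u x"
    and hom: "\<And>c x. 0 < c \<Longrightarrow> u (c *\<^sub>R x) = u x"
  shows "emeasure lborel {x. x \<noteq> 0 \<and> norm x \<le> u x}
       = (\<integral>\<^sup>+x. indicator (cball 0 1 - {0}) x * ennreal (u x ^ DIM('a)) \<partial>lborel)"
proof -
  let ?n = "DIM('a)"
  have n: "?n > 0" by simp
  \<comment> \<open>\<open>G\<close> is the weight described above, restricted to the radial set;
    \<open>H\<close> is what \<open>G\<close> becomes when \<open>x\<close> is replaced by
    \<open>x / s\<close> and the Jacobian \<open>(1/s) ^ ?n\<close> is included. The rescaling turns
    the bound on \<open>s\<close> into \<open>norm x \<le> 1\<close>, and the radial bound into a
    lower bound on \<open>s\<close>.\<close>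
  define G where "G x s = (if x \<noteq> 0 \<and> norm x \<le> u x \<and> 0 < s \<and> s * norm x \<le> 1
      then ennreal (?n * norm x ^ ?n * s ^ (?n - 1)) else 0)" for x s
  define H where "H x s = (if x \<noteq> 0 \<and> norm x \<le> 1 \<and> norm x \<le> s * u x \<and> 0 < s
      then ennreal (?n * norm x ^ ?n / s ^ (?n + 1)) else 0)" for x s
  have [measurable]: "(\<lambda>(x,s). G x s) \<in> borel_measurable (lborel \<Otimes>\<^sub>M lborel)"
    "(\<lambda>(x,s). H x s) \<in> borel_measurable (lborel \<Otimes>\<^sub>M lborel)"
    unfolding G_def H_def by measurable
  have [measurable]: "G x \<in> borel_measurable borel" "(\<lambda>x. G x s) \<in> borel_measurable borel" for x s
    unfolding G_def by measurable
  have innerG: "(\<integral>\<^sup>+s. G x s \<partial>lborel) = indicator {x. x \<noteq> 0 \<and> norm x \<le> u x} x" for x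
  proof (cases "x \<noteq> 0 \<and> norm x \<le> u x")
    case True
    have "(\<integral>\<^sup>+s. G x s \<partial>lborel)
        = (\<integral>\<^sup>+s. ennreal (?n * norm x ^ ?n * s ^ (?n - 1)) * indicator {0..1 / norm x} s \<partial>lborel)"
    proof (rule nn_integral_cong_AE)
      have *: "s \<le> 1 / norm x \<longleftrightarrow> s * norm x \<le> 1" for s using True by (simp add: pos_le_divide_eq)
      \<comment> \<open>The interval contains \<open>s = 0\<close>, where \<open>G\<close> is 0 by
        definition; this single point is null.\<close>
      from AE_lborel_singleton[of "0::real"]
      show "AE s in lborel. G x s = ennreal (?n * norm x ^ ?n * s ^ (?n - 1)) * indicator {0..1 / norm x} s"
        by eventually_elim (use True * in \<open>auto simp: G_def indicator_def\<close>)
    qed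
    also have "\<dots> = ennreal (norm x ^ ?n * (1 / norm x) ^ ?n - norm x ^ ?n * 0 ^ ?n)"
      using True
      by (intro nn_integral_FTC_Icc) (auto intro!: derivative_eq_intros simp: mult_ac)
    also have "\<dots> = 1" using True n by (simp add: power_0_left power_one_over)
    finally show ?thesis using True by simp
  next
    case False
    then have "G x = (\<lambda>_. 0)" by (auto simp: G_def)
    then show ?thesis using False by auto
  qed
  have innerH: "(\<integral>\<^sup>+s. H x s \<partial>lborel) = indicator (cball 0 1 - {0}) x * ennreal (u x ^ ?n)" for x
  proof (cases "x \<in> cball 0 1 - {0}")
    case True
    then have x: "x \<noteq> 0" "norm x \<le> 1" and u: "u x > 0" using pos by auto
    let ?w = "norm x / u x"
    have w: "?w > 0" using x u by simp
    have "(\<integral>\<^sup>+s. H x s \<partial>lborel)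
        = (\<integral>\<^sup>+s. ennreal (?n * norm x ^ ?n / s ^ (?n + 1)) * indicator {?w..} s \<partial>lborel)"
    proof (rule nn_integral_cong)
      fix s
      have "?w \<le> s \<longleftrightarrow> norm x \<le> s * u x" using u by (simp add: pos_divide_le_eq)
      moreover have "?w \<le> s \<Longrightarrow> 0 < s" using w by linarith
      ultimately show "H x s = ennreal (?n * norm x ^ ?n / s ^ (?n + 1)) * indicator {?w..} s"
        using x by (auto simp: H_def indicator_def)
    qed
    \<comment> \<open>The antiderivative vanishes at infinity, and at the lower end
      \<open>?w = norm x / u x\<close> the powers of \<open>norm x\<close> cancel, leaving
      \<open>u x ^ ?n\<close>.\<close>
    also have "\<dots> = ennreal (0 - (- (norm x ^ ?n / ?w ^ ?n)))"
    proof (rule nn_integral_FTC_atLeast)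
      fix s assume s: "?w \<le> s"
      then have "s > 0" using w by linarith
      then show "((\<lambda>s. - (norm x ^ ?n / s ^ ?n)) has_real_derivative ?n * norm x ^ ?n / s ^ (?n + 1)) (at s)"
      proof -
        have p: "s ^ ?n = s * s ^ (?n - 1)" using n by (metis Suc_pred' power_Suc)
        show ?thesis
          using \<open>s > 0\<close> by (auto intro!: derivative_eq_intros simp: divide_simps p)
      qed
      show "0 \<le> ?n * norm x ^ ?n / s ^ (?n + 1)" using \<open>s > 0\<close> by simp
    next
      have "filterlim (\<lambda>s::real. s ^ ?n) at_top at_top"
        using n by (intro filterlim_pow_at_top filterlim_ident) 
      from tendsto_minus[OF tendsto_divide_0[OF tendsto_const filterlim_at_top_imp_at_infinity[OF this]]]
      show "((\<lambda>s. - (norm x ^ ?n / s ^ ?n)) \<longlongrightarrow> 0) at_top" by simp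
    qed simp
    also have "\<dots> = ennreal (u x ^ ?n)" using x u by (simp add: power_divide)
    finally show ?thesis using True by simp
  qed (auto simp: H_def)
  have scale: "(\<integral>\<^sup>+x. G x s \<partial>lborel) = (\<integral>\<^sup>+x. H x s \<partial>lborel)" for s
  proof (cases "s > 0")
    case True
    have "(1 / s) ^ ?n * (?n * (norm x / s) ^ ?n * s ^ (?n - 1)) = ?n * norm x ^ ?n / s ^ (?n + 1)" for x :: 'a
    proof -
      have p: "s ^ ?n = s * s ^ (?n - 1)" using n by (metis Suc_pred' power_Suc)
      show ?thesis using True by (simp add: power_divide divide_simps p)
    qed
    then have "ennreal ((1/s) ^ ?n) * G ((1/s) *\<^sub>R x) s = H x s" for x
      using True hom[of "1/s" x]
      by (auto simp: G_def H_def ennreal_mult'[symmetric] field_simps)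
    then show ?thesis by (subst nn_integral_lborel_scale[OF _ True]) simp_all
  qed (simp add: G_def H_def)
  have "emeasure lborel {x. x \<noteq> 0 \<and> norm x \<le> u x} = (\<integral>\<^sup>+x. (\<integral>\<^sup>+s. G x s \<partial>lborel) \<partial>lborel)"
    by (subst innerG) simp
  also have "\<dots> = (\<integral>\<^sup>+s. (\<integral>\<^sup>+x. G x s \<partial>lborel) \<partial>lborel)"
    by (rule lborel_pair.Fubini'[symmetric]) simp
  also have "\<dots> = (\<integral>\<^sup>+s. (\<integral>\<^sup>+x. H x s \<partial>lborel) \<partial>lborel)"
    by (simp add: scale)
  also have "\<dots> = (\<integral>\<^sup>+x. (\<integral>\<^sup>+s. H x s \<partial>lborel) \<partial>lborel)"
    by (rule lborel_pair.Fubini') simp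
  finally show ?thesis by (simp add: innerH)
qed

text \<open>Young's inequality for \<open>t ^ n\<close> and 1 with weights \<open>k / n\<close> and
  \<open>1 - k / n\<close>. Equality holds at \<open>t = 1\<close>, so nothing is lost when the
  bound is used for a ball and \<open>t\<close> is the ratio to its own radius.\<close>

lemma power_le_affine:
  fixes t :: real
  assumes "0 \<le> t" "k \<le> n" "0 < n"
  shows "t ^ k \<le> (real k / real n) * t ^ n + (1 - real k / real n)"
proof (cases "t = 0")
  case True
  then show ?thesis using assms by (auto simp: power_0_left)
next
  case False
  then have t: "t > 0" using assms by simp
  have "(t ^ n) powr (real k / real n) * 1 powr (1 - real k / real n)
      \<le> real k / real n * t ^ n + (1 - real k / real n) * 1"
    using assms t by (intro Youngs_inequality_0) auto
  moreover have "(t ^ n) powr (real k / real n) = t ^ k"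
    using t assms by (simp add: powr_powr powr_realpow[symmetric])
  ultimately show ?thesis by simp
qed

text \<open>The affine bound above, applied to the ratio of the radial function to the radius of the
  ball of the same volume, replaces Hoelder's inequality.\<close>

lemma integral_radial_power_le:
  fixes D :: "'a::euclidean_space set"
  assumes D: "star_body D" and k: "k \<le> DIM('a)"
  defines "\<omega> \<equiv> unit_ball_vol (real DIM('a))"
  shows "(LINT \<theta>|sphere_measure UNIV. radial_fun D \<theta> ^ k)
    \<le> real DIM('a) * \<omega> powr (real (DIM('a) - k) / real DIM('a)) * measure lebesgue D powr (real k / real DIM('a))"
proof -
  let ?n = "DIM('a)" and ?V = "measure lebesgue D" and ?\<rho> = "radial_fun D"
  have n: "?n > 0" by simp
  have ss: "star_shaped D" and cont: "continuous_on (sphere 0 1) ?\<rho>" using D by (auto simp: star_body_def)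
  note V = measure_star_shaped_pos[OF ss]
  have \<omega>: "\<omega> > 0" by (simp add: \<omega>_def)
  \<comment> \<open>The radius of the ball with the volume of \<open>D\<close>.\<close>
  define c where "c = (?V / \<omega>) powr (1 / ?n)"
  have c: "c > 0" using V \<omega> by (simp add: c_def)
  have cn: "c ^ ?n = ?V / \<omega>" using V \<omega> n by (simp add: c_def powr_power)
  define u where "u x = indicator (- {0}) x * ?\<rho> (sgn x)" for x
  have int: "integrable lborel (cone_extension g)" if "continuous_on (sphere 0 1) g" for g :: "'a \<Rightarrow> real"
    using integrable_cone_extension[OF finite_Basis orthonormal_family_Basis _ that]
    by (simp add: lborel_eq_frame_measure)
  \<comment> \<open>The cone extension is cut off at the open unit ball and the polar formula at the
    closed one, and the radial set omits the origin; the argument therefore runs through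
    inequalities.\<close>
  have vol: "(LINT x|lborel. cone_extension (\<lambda>\<theta>. ?\<rho> \<theta> ^ ?n) x) \<le> ?V"
  proof -
    have "(\<integral>\<^sup>+x. ennreal (cone_extension (\<lambda>\<theta>. ?\<rho> \<theta> ^ ?n) x) \<partial>lborel)
        \<le> (\<integral>\<^sup>+x. indicator (cball 0 1 - {0}) x * ennreal (u x ^ ?n) \<partial>lborel)"
      by (intro nn_integral_mono) (auto simp: cone_extension_def u_def indicator_def)
    also have "\<dots> = emeasure lborel {x. x \<noteq> 0 \<and> norm x \<le> u x}"
    proof (rule emeasure_radial_set[symmetric])
      have "(\<lambda>x. indicator (- {0}) x *\<^sub>R ?\<rho> (sgn x)) \<in> borel_measurable borel"
        using cont by (intro borel_measurable_continuous_on_indicator continuous_on_sgn_compose) auto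
      then show "u \<in> borel_measurable borel" by (simp add: u_def[abs_def])
      show "0 < u x" if "x \<noteq> 0" for x
        using that radial_fun_pos[OF ss, of "sgn x"] by (simp add: u_def norm_sgn)
      show "u (c *\<^sub>R x) = u x" if "0 < c" for c x
        using that by (auto simp: u_def indicator_def sgn_scaleR)
    qed
    also have "\<dots> \<le> emeasure lborel D"
    proof (rule emeasure_mono)
      show "{x. x \<noteq> 0 \<and> norm x \<le> u x} \<subseteq> D"
      proof safe
        fix x assume x: "x \<noteq> 0" "norm x \<le> u x"
        then have "norm x *\<^sub>R sgn x \<in> D"
          by (intro radial_fun_segment[OF ss]) (auto simp: u_def norm_sgn)
        then show "x \<in> D" using x by (simp add: sgn_div_norm)
      qed
      show "D \<in> sets lborel" using ss by (auto simp: star_shaped_def intro: borel_compact)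
    qed
    also have "\<dots> = ennreal ?V" using V by simp
    finally have "(\<integral>\<^sup>+x. ennreal (cone_extension (\<lambda>\<theta>. ?\<rho> \<theta> ^ ?n) x) \<partial>lborel) \<le> ennreal ?V" .
    moreover have "0 \<le> cone_extension (\<lambda>\<theta>. ?\<rho> \<theta> ^ ?n) x" for x
      using radial_fun_pos[OF ss, of "sgn x"]
      by (auto simp: cone_extension_def indicator_def norm_sgn less_imp_le)
    ultimately show ?thesis
      using int[OF continuous_on_power[OF cont]] V by (simp add: nn_integral_eq_integral)
  qed
  have one: "(LINT x|(lborel :: 'a measure). cone_extension (\<lambda>_. 1) x) = \<omega>"
  proof -
    have "(LINT x|frame_measure Basis (\<lambda>x :: 'a. x). cone_extension (\<lambda>_. 1) x) = 1 * \<omega>"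
      unfolding \<omega>_def
      by (intro integral_cone_extension_const finite_Basis orthonormal_family_Basis nonempty_Basis)
    then show ?thesis by (simp add: lborel_eq_frame_measure)
  qed
  have "(LINT x|lborel. cone_extension (\<lambda>\<theta>. ?\<rho> \<theta> ^ k) x)
      \<le> (LINT x|lborel. c ^ k * (k / ?n / c ^ ?n * cone_extension (\<lambda>\<theta>. ?\<rho> \<theta> ^ ?n) x
          + (1 - k / ?n) * cone_extension (\<lambda>_. 1) x))"
  proof (rule integral_mono)
    fix x
    have "?\<rho> \<theta> ^ k \<le> c ^ k * (k / ?n / c ^ ?n * ?\<rho> \<theta> ^ ?n + (1 - k / ?n))" if "norm \<theta> = 1" for \<theta>
    proof -
      have "(?\<rho> \<theta> / c) ^ k \<le> (k / ?n) * (?\<rho> \<theta> / c) ^ ?n + (1 - k / ?n)"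
        using c radial_fun_pos[OF ss that] k by (intro power_le_affine) auto
      then show ?thesis using c by (simp add: power_divide pos_divide_le_eq mult.commute)
    qed
    then show "cone_extension (\<lambda>\<theta>. ?\<rho> \<theta> ^ k) x
      \<le> c ^ k * (k / ?n / c ^ ?n * cone_extension (\<lambda>\<theta>. ?\<rho> \<theta> ^ ?n) x + (1 - k / ?n) * cone_extension (\<lambda>_. 1) x)"
      by (auto simp: cone_extension_def indicator_def norm_sgn)
  qed (intro int Bochner_Integration.integrable_add integrable_mult_right continuous_on_power continuous_on_const cont)+
  also have "\<dots> = c ^ k * (k / ?n / c ^ ?n * (LINT x|lborel. cone_extension (\<lambda>\<theta>. ?\<rho> \<theta> ^ ?n) x) + (1 - k / ?n) * \<omega>)"
    using int[OF continuous_on_power[OF cont]] int[OF continuous_on_const, of 1] by (simp add: one)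
  also have "\<dots> \<le> c ^ k * (k / ?n / c ^ ?n * ?V + (1 - k / ?n) * \<omega>)"
    using c vol by (intro mult_left_mono add_right_mono) auto
  \<comment> \<open>By the choice of \<open>c\<close>, dividing \<open>?V\<close> by
    \<open>c ^ ?n\<close> gives \<omega>, so the two weights recombine to 1.\<close>
  also have "\<dots> = c ^ k * \<omega>"
    using V \<omega> n by (simp add: cn field_simps)
  also have "c ^ k = (?V / \<omega>) powr (k / ?n)"
    using V \<omega> by (simp add: c_def powr_power)
  also have "(?V / \<omega>) powr (k / ?n) * \<omega> = \<omega> powr (real (?n - k) / ?n) * ?V powr (k / ?n)"
  proof -
    have "\<omega> powr (real (?n - k) / ?n) * \<omega> powr (k / ?n) = \<omega> powr 1"
      unfolding powr_add[symmetric] using k n by (simp add: of_nat_diff add_divide_distrib[symmetric])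
    then show ?thesis using V \<omega> by (simp add: powr_divide field_simps)
  qed
  finally show ?thesis
    using integral_sphere_measure_UNIV[OF continuous_on_power[OF cont]] by (simp add: mult.assoc mult_left_mono)
qed

subsection \<open>Generalized intersection bodies\<close>

text \<open>Measurability of the Radon transform on the Grassmannian plays no role, since a non-integrable
  function has Bochner integral 0.\<close>

lemma BP_integral_le:
  fixes D :: "'a::euclidean_space set"
  assumes D: "D \<in> BP k" and k: "k < DIM('a)" and g: "continuous_on (sphere 0 1) g"
    and M: "0 \<le> M" "\<And>H. H \<in> Gr (DIM('a) - k) \<Longrightarrow> (LINT \<theta>|sphere_measure H. g \<theta>) \<le> M"
  defines "m \<equiv> real (DIM('a) - k)"
  shows "(LINT \<theta>|sphere_measure UNIV. radial_fun D \<theta> ^ k * g \<theta>)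
    \<le> (LINT \<theta>|sphere_measure UNIV. radial_fun D \<theta> ^ k) / (m * unit_ball_vol m) * M"
proof -
  obtain \<mu> where sets: "sets \<mu> = sets (Gr_borel (DIM('a) - k) :: 'a set measure)" and fin: "finite_measure \<mu>"
    and eq: "\<And>g. continuous_on (sphere 0 1) g \<Longrightarrow>
      (LINT \<theta>|sphere_measure UNIV. radial_fun D \<theta> ^ k * g \<theta>) = (LINT H|\<mu>. spherical_radon g H)"
    using D unfolding BP_def by blast
  interpret finite_measure \<mu> by fact
  have space: "space \<mu> = Gr (DIM('a) - k)"
    using sets_eq_imp_space_eq[OF sets] by (simp add: Gr_borel_def space_measure_of_conv)
  have m: "m * unit_ball_vol m > 0" using k by (simp add: m_def)
  have one: "(LINT \<theta>|sphere_measure UNIV. radial_fun D \<theta> ^ k) = m * unit_ball_vol m * measure \<mu> (space \<mu>)"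
  proof -
    have "(LINT \<theta>|sphere_measure UNIV. radial_fun D \<theta> ^ k * 1) = (LINT H|\<mu>. spherical_radon (\<lambda>_. 1) H)"
      by (intro eq continuous_on_const)
    also have "\<dots> = (LINT H|\<mu>. m * unit_ball_vol m)"
    proof (intro Bochner_Integration.integral_cong refl)
      fix H assume "H \<in> space \<mu>"
      then have "spherical_radon (\<lambda>_. 1) H = 1 * (m * unit_ball_vol m)"
        unfolding space spherical_radon_def m_def
        by (rule integral_sphere_measure_const) (use k in simp)
      then show "spherical_radon (\<lambda>_. 1) H = m * unit_ball_vol m" by simp
    qed
    finally show ?thesis by simp
  qed
  have "(LINT \<theta>|sphere_measure UNIV. radial_fun D \<theta> ^ k * g \<theta>) = (LINT H|\<mu>. spherical_radon g H)"
    by (rule eq[OF g])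
  also have "\<dots> \<le> measure \<mu> (space \<mu>) * M"
  proof (cases "integrable \<mu> (spherical_radon g)")
    case True
    have "(LINT H|\<mu>. spherical_radon g H) \<le> (LINT H|\<mu>. M)"
    proof (rule integral_mono[OF True])
      show "spherical_radon g H \<le> M" if "H \<in> space \<mu>" for H
        using M(2) that unfolding space spherical_radon_def .
    qed simp
    then show ?thesis by simp
  next
    case False
    then show ?thesis using M(1) by (simp add: not_integrable_integral_eq)
  qed
  also have "measure \<mu> (space \<mu>) = (LINT \<theta>|sphere_measure UNIV. radial_fun D \<theta> ^ k) / (m * unit_ball_vol m)"
    using m unfolding one by (metis less_numeral_extra(3) nonzero_mult_div_cancel_left)
  finally show ?thesis .
qed

lemma integral_sphere_UNIV_mono:
  fixes f g :: "'a::euclidean_space \<Rightarrow> real"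
  assumes f: "continuous_on (sphere 0 1) f" and g: "continuous_on (sphere 0 1) g"
    and le: "\<And>x. norm x = 1 \<Longrightarrow> f x \<le> g x"
  shows "(LINT \<theta>|sphere_measure UNIV. f \<theta>) \<le> (LINT \<theta>|sphere_measure UNIV. g \<theta>)"
proof -
  have int: "integrable lborel (cone_extension h)" if "continuous_on (sphere 0 1) h" for h :: "'a \<Rightarrow> real"
    using integrable_cone_extension[OF finite_Basis orthonormal_family_Basis _ that]
    by (simp add: lborel_eq_frame_measure)
  have "(LINT x|lborel. cone_extension f x) \<le> (LINT x|lborel. cone_extension g x)"
    using le by (intro integral_mono int f g) (auto simp: cone_extension_def indicator_def norm_sgn)
  then show ?thesis
    unfolding integral_sphere_measure_UNIV[OF f] integral_sphere_measure_UNIV[OF g]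
    by (rule mult_left_mono) simp
qed

text \<open>The estimate for a single body of the class. The right-hand side depends on
  \<open>D\<close> only through its volume, which prepares for the infimum over
  \<open>D\<close>.\<close>

lemma integral_radial_le_of_BP:
  fixes K D :: "'a::euclidean_space set"
  assumes K: "star_body K" and D: "D \<in> BP k" "K \<subseteq> D" and k: "k < DIM('a)"
    and g: "continuous_on (sphere 0 1) g" "\<And>x. norm x = 1 \<Longrightarrow> 0 \<le> g x"
    and M: "0 \<le> M" "\<And>H. H \<in> Gr (DIM('a) - k) \<Longrightarrow> (LINT \<theta>|sphere_measure H. g \<theta>) \<le> M"
  defines "n \<equiv> real DIM('a)" and "m \<equiv> real (DIM('a) - k)"
  shows "(LINT \<theta>|sphere_measure UNIV. radial_fun K \<theta> ^ k * g \<theta>)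
    \<le> n * unit_ball_vol n powr (m / n) / (m * unit_ball_vol m)
        * measure lebesgue D powr (real k / n) * M"
proof -
  have sD: "star_body D" using D by (auto simp: BP_def)
  have ss: "star_shaped K" "star_shaped D"
    and c: "continuous_on (sphere 0 1) (radial_fun K)" "continuous_on (sphere 0 1) (radial_fun D)"
    using K sD by (auto simp: star_body_def)
  have m: "m * unit_ball_vol m > 0" using k by (simp add: m_def)
  have "(LINT \<theta>|sphere_measure UNIV. radial_fun K \<theta> ^ k * g \<theta>)
      \<le> (LINT \<theta>|sphere_measure UNIV. radial_fun D \<theta> ^ k * g \<theta>)"
  proof (rule integral_sphere_UNIV_mono)
    fix x :: 'a assume x: "norm x = 1"
    show "radial_fun K x ^ k * g x \<le> radial_fun D x ^ k * g x"
      using radial_fun_pos[OF ss(1) x]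
      by (intro mult_right_mono power_mono radial_fun_mono ss D(2) x g(2)) simp
  qed (intro continuous_on_mult continuous_on_power c g(1))+
  also have "\<dots> \<le> (LINT \<theta>|sphere_measure UNIV. radial_fun D \<theta> ^ k) / (m * unit_ball_vol m) * M"
    unfolding m_def by (rule BP_integral_le[OF D(1) k g(1) M])
  also have "\<dots> \<le> (n * unit_ball_vol n powr (m / n) * measure lebesgue D powr (real k / n))
      / (m * unit_ball_vol m) * M"
  proof (intro mult_right_mono divide_right_mono)
    show "(LINT \<theta>|sphere_measure UNIV. radial_fun D \<theta> ^ k)
        \<le> n * unit_ball_vol n powr (m / n) * measure lebesgue D powr (real k / n)"
      unfolding n_def m_def by (rule integral_radial_power_le[OF sD less_imp_le[OF k]])
  qed (use m M(1) in simp_all)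
  finally show ?thesis by simp
qed

section \<open>Passing to the infimum in the extended non-negative reals\<close>

text \<open>Multiplication of extended non-negative reals fails to be continuous only at products of
  0 and infinity, and \<open>x * x ^ k\<close> is never of that form.\<close>

lemma tendsto_power_ennreal: "((\<lambda>y :: ennreal. y ^ k) \<longlongrightarrow> x ^ k) (at x within S)"
proof (induction k)
  case (Suc k)
  have "((\<lambda>y. y * y ^ k) \<longlongrightarrow> x * x ^ k) (at x within S)"
  proof (rule tendsto_mult_ennreal[OF tendsto_ident_at Suc])
    show "\<not> (x = 0 \<and> x ^ k = \<infinity> \<or> x = \<infinity> \<and> x ^ k = 0)"
      by (cases "k = 0") (auto simp: power_0_left power_eq_top_ennreal)
  qed
  then show ?case by simp
qed simp

text \<open>A monotone map that is continuous from the right commutes with the infimum of a nonempty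
  set. Finiteness of \<open>a\<close> gives the continuity, and \<open>X = {}\<close> is excluded
  because its infimum is \<open>top\<close>, about which the bounds on members say nothing.\<close>

lemma le_mult_Inf_power_ennreal:
  fixes L a :: ennreal
  assumes "a < top" "X \<noteq> {}" "\<And>x. x \<in> X \<Longrightarrow> L \<le> a * x ^ k"
  shows "L \<le> a * Inf X ^ k"
proof -
  have "a * Inf X ^ k = (INF x\<in>X. a * x ^ k)"
  proof (rule continuous_at_Inf_mono)
    show "mono (\<lambda>x. a * x ^ k)" by (intro monoI mult_left_mono power_mono) auto
    show "continuous (at_right (Inf X)) (\<lambda>x. a * x ^ k)"
      unfolding continuous_within using assms(1) by (intro ennreal_tendsto_cmult tendsto_power_ennreal)
  qed (use assms in auto)
  then show ?thesis using assms(3) by (simp add: INF_greatest)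
qed

text \<open>The maximum is expressed by a maximising \<open>E\<close>. The inequality lives in
  \<open>ennreal\<close> because \<open>d_ovr\<close> may be infinite; the integrands are
  non-negative, so the conversions by \<open>ennreal\<close> truncate nothing.\<close>

theorem theorem1p2:
  fixes K :: "(real ^ 'n) set" and f :: "real ^ 'n \<Rightarrow> real" and k n :: nat
  assumes n: "n = CARD('n)"
    and k: "1 \<le> k" "k \<le> n - 1"
    and K: "star_body K" "origin_symmetric K"
    and f: "continuous_on UNIV f" "\<And>x. f x \<ge> 0" "\<And>x. f (- x) = f x"
  shows "\<exists>E\<in>Gr (n - k).
    (\<forall>F\<in>Gr (n - k).
       (LINT \<theta>|sphere_measure F. radial_fun K \<theta> ^ (n - k - 1) * f (radial_fun K \<theta> *\<^sub>R \<theta>))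
       \<le> (LINT \<theta>|sphere_measure E. radial_fun K \<theta> ^ (n - k - 1) * f (radial_fun K \<theta> *\<^sub>R \<theta>))) \<and>
    ennreal (LINT \<theta>|sphere_measure UNIV. radial_fun K \<theta> ^ (n - 1) * f (radial_fun K \<theta> *\<^sub>R \<theta>))
    \<le> ennreal (real n * unit_ball_vol (real n) powr (real (n - k) / real n)
               / (real (n - k) * unit_ball_vol (real (n - k))))
      * d_ovr K (BP k) ^ k
      * ennreal (measure lebesgue K powr (real k / real n))
      * ennreal (LINT \<theta>|sphere_measure E. radial_fun K \<theta> ^ (n - k - 1) * f (radial_fun K \<theta> *\<^sub>R \<theta>))"
proof -
  let ?g = "\<lambda>\<theta>. radial_fun K \<theta> ^ (n - k - 1) * f (radial_fun K \<theta> *\<^sub>R \<theta>)"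
  let ?L = "LINT \<theta>|sphere_measure UNIV. radial_fun K \<theta> ^ (n - 1) * f (radial_fun K \<theta> *\<^sub>R \<theta>)"
  let ?V = "measure lebesgue K"
  define C where "C = real n * unit_ball_vol (real n) powr (real (n - k) / real n)
      / (real (n - k) * unit_ball_vol (real (n - k)))"
  have dim: "DIM(real ^ 'n) = n" by (simp add: n)
  have kn: "k < n" "1 \<le> n - k" "n - k \<le> n" "0 < n" using k by auto
  have \<omega>: "0 < unit_ball_vol (real j)" for j by simp
  have C: "C > 0"
    unfolding C_def using kn \<omega>[of n]
    by (intro divide_pos_pos mult_pos_pos \<omega>) (simp_all del: unit_ball_vol_pos)
  have ss: "star_shaped K" and \<rho>: "continuous_on (sphere 0 1) (radial_fun K)"
    using K(1) by (auto simp: star_body_def)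
  note V = measure_star_shaped_pos(1)[OF ss]
  have g: "continuous_on (sphere 0 1) ?g"
    using f(1) by (intro continuous_on_mult continuous_on_power \<rho> continuous_on_compose2[OF f(1)]
        continuous_on_scaleR continuous_on_id) auto
  have g0: "0 \<le> ?g x" if "norm x = 1" for x
    using radial_fun_pos[OF ss that] f(2) by simp
  \<comment> \<open>The \<open>n - 1\<close> powers of the radial function split into
    \<open>k\<close>, which are compared with those of \<open>D\<close>, and the
    \<open>n - k - 1\<close> inside \<open>?g\<close>.\<close>
  have Lg: "?L = (LINT \<theta>|sphere_measure UNIV. radial_fun K \<theta> ^ k * ?g \<theta>)"
  proof -
    have "n - 1 = k + (n - k - 1)" using k by simp
    then show ?thesis by (simp only: power_add mult.assoc)
  qed
  obtain E where E: "E \<in> Gr (n - k)"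
    and max: "\<And>F. F \<in> Gr (n - k) \<Longrightarrow> (LINT \<theta>|sphere_measure F. ?g \<theta>) \<le> (LINT \<theta>|sphere_measure E. ?g \<theta>)"
    using sphere_integral_attains_max[of "n - k" ?g] kn g dim by auto
  define M where "M = (LINT \<theta>|sphere_measure E. ?g \<theta>)"
  have nonneg: "0 \<le> M"
  proof -
    obtain B where B: "finite B" "orthonormal_family B (\<lambda>x. x)" "span ((\<lambda>x. x) ` B) = E"
      using E by (rule Gr_orthonormal_family)
    have "0 \<le> cone_extension ?g x" for x
      using g0[of "sgn x"] by (auto simp: cone_extension_def indicator_def norm_sgn)
    then show ?thesis
      unfolding M_def integral_sphere_measure[OF B g] by (intro mult_nonneg_nonneg integral_nonneg) auto
  qed
  have "ennreal ?L \<le> ennreal C * d_ovr K (BP k) ^ k * ennreal (?V powr (real k / real n)) * ennreal M"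
  proof (cases "{D \<in> BP k. K \<subseteq> D} = {}")
    case True
    have d: "d_ovr K (BP k) = top" unfolding d_ovr_def True by simp
    show ?thesis
    proof (cases "M = 0")
      \<comment> \<open>In \<open>ennreal\<close> the product of \<open>top\<close> and 0 is 0, so
        here the left-hand side itself has to vanish.\<close>
      case M: True
      have "?g \<theta> = 0" if \<theta>: "norm \<theta> = 1" for \<theta>
      proof (rule ccontr)
        assume "?g \<theta> \<noteq> 0"
        then have pos: "0 < ?g \<theta>" using g0[OF \<theta>] by linarith
        obtain F where F: "F \<in> Gr (n - k)" "\<theta> \<in> F"
          using ex_Gr_containing[of "n - k" \<theta>] kn \<theta> dim by auto
        have "0 < (LINT \<theta>|sphere_measure F. ?g \<theta>)"
          by (rule integral_sphere_measure_pos[OF F(1) kn(2) g g0 F(2) \<theta> pos])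
        then show False using max[OF F(1)] M by (simp add: M_def)
      qed
      then have le: "radial_fun K x ^ k * ?g x \<le> 0" if "norm x = 1" for x
        using that by (simp only: mult_zero_right order_refl)
      have "(LINT \<theta>|sphere_measure UNIV. radial_fun K \<theta> ^ k * ?g \<theta>)
          \<le> (LINT \<theta>|sphere_measure UNIV. (\<lambda>_ :: real ^ 'n. 0) \<theta>)"
        by (rule integral_sphere_UNIV_mono[OF continuous_on_mult[OF continuous_on_power[OF \<rho>] g]
              continuous_on_const le])
      then have "?L \<le> 0" unfolding Lg by (simp only: integral_zero)
      then show ?thesis by (simp add: ennreal_neg)
    next
      case False
      then have "0 < M" using nonneg by simp
      \<comment> \<open>Since \<open>k\<close> is at least 1, \<open>top ^ k\<close> is
        \<open>top\<close>, and all other factors are positive, so the right-hand side is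
        infinite.\<close>
      then show ?thesis using C V k(1)
        by (simp add: d ennreal_mult_top ennreal_top_mult power_eq_top_ennreal)
    qed
  next
    case False
    let ?r = "\<lambda>D. ennreal ((measure lebesgue D / ?V) powr (1 / real DIM(real ^ 'n)))"
    let ?a = "ennreal (C * ?V powr (real k / real n) * M)"
    have "ennreal ?L \<le> ?a * Inf (?r ` {D \<in> BP k. K \<subseteq> D}) ^ k"
    proof (rule le_mult_Inf_power_ennreal)
      fix x assume "x \<in> ?r ` {D \<in> BP k. K \<subseteq> D}"
      then obtain D where D: "D \<in> BP k" "K \<subseteq> D" and x: "x = ?r D" by blast
      have ssD: "star_shaped D" using D by (simp add: BP_def star_body_def)
      note VD = measure_star_shaped_pos(1)[OF ssD]
      have "?L \<le> C * measure lebesgue D powr (real k / real n) * M"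
        using integral_radial_le_of_BP[OF K(1) D, of ?g M] kn(1) g g0 nonneg max
        unfolding Lg C_def M_def dim by blast
      \<comment> \<open>Factoring out the power of \<open>?V\<close> produces the
        \<open>k\<close>-th power of the volume ratio, the expression whose infimum defines
        \<open>d_ovr\<close>.\<close>
      also have "measure lebesgue D powr (real k / real n)
          = ?V powr (real k / real n) * ((measure lebesgue D / ?V) powr (1 / real n)) ^ k"
        using V VD by (simp add: powr_power powr_divide power_divide)
      finally have "?L \<le> C * ?V powr (real k / real n) * M * ((measure lebesgue D / ?V) powr (1 / real n)) ^ k"
        by (simp add: mult_ac)
      then show "ennreal ?L \<le> ?a * x ^ k"
        unfolding x dim using C nonneg by (simp add: ennreal_power ennreal_mult'[symmetric] ennreal_leI)
    qed (use False in auto)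
    then show ?thesis
      unfolding d_ovr_def using C nonneg by (simp add: ennreal_mult mult_ac)
  qed
  then show ?thesis using E max unfolding C_def M_def by blast
qed

end
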